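(* Let $X$ be a $G$-valued continuous cocycle, where $G$ is one of the following groups: the symplectic group $Sp(n,\mathbb{R})$ ($n$ even), the group $SL(n,\mathbb{R})$, the orthogonal group $O(n)$, or the unitary group $U(n)$. Suppose $X$ is $GL(n,\mathbb{C})$-reducible. Then $X$ is $G$-reducible modulo $2$ if $G=Sp(n,\mathbb{R})$, $SL(n,\mathbb{R})$ or $O(n)$, and $G$-reducible modulo $1$ if $G=U(n)$.
   Context: Let $\mathbb{T}^d=\mathbb{R}^d/\mathbb{Z}^d$ and, for an integer $N\ge 1$, $N\mathbb{T}^d=\mathbb{R}^d/(N\mathbb{Z})^d$; functions on $\mathbb{T}^d$ are also viewed as functions on $N\mathbb{T}^d$ through the canonical projection. Fix $\omega\in\mathbb{R}^d$ rationally independent, i.e. $\langle k,\omega\rangle\neq 0$ for all $k\in\mathbb{Z}^d\setminus\{0\}$. Let $G$ be a Lie subgroup of $GL(n,\mathbb{C})$ with Lie algebra $\mathcal{G}$. A $G$-valued continuous cocycle is the map $X:\mathbb{R}\times\mathbb{T}^d\to G$, $(t,\theta)\mapsto X^t(\theta)$, solving $\frac{d}{dt}X^t(\theta)=A(\theta+t\omega)X^t(\theta)$, $X^0(\theta)=Id$ for all $\theta$, for some continuous $A:\mathbb{T}^d\to\mathcal{G}$. It satisfies $X^{t+s}(\theta)=X^t(\theta+s\omega)X^s(\theta)$. For a Lie subgroup $G'$ of $GL(n,\mathbb{C})$ with Lie algebra $\mathcal{G}'$, a continuous cocycle $X$ with values in $G'$ is $G'$-reducible modulo $N$ if there exist a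 continuous $Z:N\mathbb{T}^d\to G'$ and $B\in\mathcal{G}'$ such that $X^t(\theta)=Z(\theta+t\omega)^{-1}e^{tB}Z(\theta)$ for all $t\in\mathbb{R}$ and all $\theta$ (in $N\mathbb{T}^d$). "$G'$-reducible" means $G'$-reducible modulo $1$. For $n$ even, $Sp(n,\mathbb{R})$ is the group of real $n\times n$ matrices $M$ with $M^*JM=J$, where $M^*$ is the transpose and $J=\begin{pmatrix}0&-I_{n/2}\\ I_{n/2}&0\end{pmatrix}$. $SL(n,\mathbb{R})$ is the group of real matrices with determinant $1$. *)

theory Defs
  imports "HOL-Analysis.Analysis"
begin

section \<open>Functions on tori\<close>

definition int_lattice :: "(real^'d) set" where
  "int_lattice = {k. \<forall>i. k $ i \<in> \<int>}"

definition rationally_independent :: "real^'d \<Rightarrow> bool" where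
  "rationally_independent \<omega> \<longleftrightarrow> (\<forall>k \<in> int_lattice - {0}. k \<bullet> \<omega> \<noteq> 0)"

text \<open>A function on the torus \<open>\<real>\<^sup>d / (N\<int>)\<^sup>d\<close> is represented by its lift to \<open>\<real>\<^sup>d\<close>.
  Because the projection is a quotient map, the function is continuous iff its lift is.\<close>

definition torus_periodic :: "nat \<Rightarrow> (real^'d \<Rightarrow> 'a) \<Rightarrow> bool" where
  "torus_periodic N f \<longleftrightarrow> (\<forall>\<theta>. \<forall>k \<in> int_lattice. f (\<theta> + real N *\<^sub>R k) = f \<theta>)"

section \<open>Matrix exponential and Lie algebras\<close>

definition mexp :: "complex^'n^'n \<Rightarrow> complex^'n^'n" where
  "mexp A = (\<Sum>k. (1 / fact k) *\<^sub>R (((**) A ^^ k) (mat 1)))"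

text \<open>This is the Lie algebra whenever \<open>G\<close> is a closed subgroup of \<open>GL(n,\<complex>)\<close>; all the
  groups below are closed.\<close>

definition lie_algebra :: "(complex^'n^'n) set \<Rightarrow> (complex^'n^'n) set" where
  "lie_algebra G = {B. \<forall>t::real. mexp (t *\<^sub>R B) \<in> G}"

section \<open>The matrix groups\<close>

definition real_entries :: "complex^'n^'m \<Rightarrow> bool" where
  "real_entries M \<longleftrightarrow> (\<forall>i j. M $ i $ j \<in> \<real>)"

definition conj_transpose :: "complex^'n^'m \<Rightarrow> complex^'m^'n" where
  "conj_transpose M = (\<chi> i j. cnj (M $ j $ i))"

definition GL_C :: "(complex^'n^'n) set" where
  "GL_C = {M. invertible M}"

definition SL_R :: "(complex^'n^'n) set" where
  "SL_R = {M. real_entries M \<and> det M = 1}"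

definition O_R :: "(complex^'n^'n) set" where
  "O_R = {M. real_entries M \<and> orthogonal_matrix M}"

definition U_C :: "(complex^'n^'n) set" where
  "U_C = {M. conj_transpose M ** M = mat 1}"

text \<open>Matrices of even size \<open>n\<close> are indexed by \<open>'m + 'm\<close> with \<open>CARD('m) = n/2\<close>: \<open>Inl\<close> enumerates
  the first half of the rows and columns and \<open>Inr\<close> the second half.\<close>

definition symplectic_J :: "complex^('m::finite + 'm)^('m + 'm)" where
  "symplectic_J = (\<chi> i j. case (i, j) of
      (Inl a, Inr b) \<Rightarrow> (if a = b then - 1 else 0)
    | (Inr a, Inl b) \<Rightarrow> (if a = b then 1 else 0)
    | _ \<Rightarrow> 0)"

definition Sp_R :: "(complex^('m::finite + 'm)^('m + 'm)) set" where
  "Sp_R = {M. real_entries M \<and> transpose M ** symplectic_J ** M = symplectic_J}"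

section \<open>Cocycles and reducibility\<close>

definition continuous_cocycle ::
    "(complex^'n^'n) set \<Rightarrow> real^'d \<Rightarrow> (real \<Rightarrow> real^'d \<Rightarrow> complex^'n^'n) \<Rightarrow> bool" where
  "continuous_cocycle G \<omega> X \<longleftrightarrow>
    (\<forall>t. torus_periodic 1 (X t)) \<and>
    (\<forall>t \<theta>. X t \<theta> \<in> G) \<and>
    (\<exists>A. continuous_on UNIV A \<and> torus_periodic 1 A \<and> range A \<subseteq> lie_algebra G \<and>
      (\<forall>\<theta>. X 0 \<theta> = mat 1) \<and>
      (\<forall>t \<theta>. ((\<lambda>s. X s \<theta>) has_vector_derivative A (\<theta> + t *\<^sub>R \<omega>) ** X t \<theta>) (at t)))"

definition reducible_mod ::
    "(complex^'n^'n) set \<Rightarrow> nat \<Rightarrow> real^'d \<Rightarrow> (real \<Rightarrow> real^'d \<Rightarrow> complex^'n^'n) \<Rightarrow> bool" where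
  "reducible_mod G N \<omega> X \<longleftrightarrow>
    (\<exists>Z B. continuous_on UNIV Z \<and> torus_periodic N Z \<and> range Z \<subseteq> G \<and> B \<in> lie_algebra G \<and>
      (\<forall>t \<theta>. X t \<theta> = matrix_inv (Z (\<theta> + t *\<^sub>R \<omega>)) ** mexp (t *\<^sub>R B) ** Z \<theta>))"

abbreviation reducible ::
    "(complex^'n^'n) set \<Rightarrow> real^'d \<Rightarrow> (real \<Rightarrow> real^'d \<Rightarrow> complex^'n^'n) \<Rightarrow> bool" where
  "reducible G \<equiv> reducible_mod G 1"

end

theory Submission
  imports Defs "HOL-Computational_Algebra.Fundamental_Theorem_Algebra"
begin

text \<open>
  Suppose \<open>X\<^sup>t(\<theta>) = Z(\<theta> + t\<omega>)\<^sup>-\<^sup>1 e\<^sup>t\<^sup>B Z(\<theta>)\<close> with \<open>Z\<close> complex and continuous on the torus. Each group in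
  question is cut out by relations \<open>C X = \<sigma>(X) C\<close>, where \<open>\<sigma>\<close> is a continuous multiplicative
  map: entrywise conjugation with \<open>C = 1\<close> for real matrices, the inverse transpose with
  \<open>C = J\<close> or \<open>C = 1\<close> for the symplectic and orthogonal relations, and the inverse adjoint with
  \<open>C = 1\<close> for unitary matrices. (The determinant is treated separately.) For each such
  relation the function \<open>W = \<sigma>(Z) C Z\<^sup>-\<^sup>1\<close> intertwines \<open>e\<^sup>t\<^sup>B\<close> with \<open>\<sigma>(e\<^sup>t\<^sup>B)\<close> along the flow. If
  \<open>W\<close> were constant, then \<open>Z(0)\<^sup>-\<^sup>1 Z\<close> would satisfy the same relation as \<open>X\<close>, and it would
  conjugate \<open>X\<close> to a one-parameter group inside the group. So it suffices to make every \<open>W\<close>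
  constant by a better choice of \<open>Z\<close>.

  The obstruction consists of resonances. Let \<open>P\<^sub>a\<close> be the spectral projections of \<open>B\<close>. Along the
  flow, a block of \<open>W\<close> between the eigenvalues \<open>a\<close> and \<open>b\<close> is \<open>e\<^sup>t\<^sup>(\<^sup>a\<^sup>-\<^sup>b\<^sup>)\<close> times a
  polynomial in \<open>t\<close>. As \<open>W\<close> is bounded and the flow is dense, the block is zero or a single
  character \<open>exp(2\<pi>i\<langle>k,\<theta>\<rangle>)\<close> with \<open>Im(a - b) = 2\<pi>\<langle>k,\<omega>\<rangle>\<close>
  (\<open>flow_quasi_polynomial_is_char\<close>). Replace \<open>Z\<close> by \<open>S Z\<close> with
  \<open>S(\<theta>) = \<Sum>\<^sub>a exp(i\<langle>\<kappa>(Im a),\<theta>\<rangle>) P\<^sub>a\<close>; this moves the imaginary parts of the eigenvalues by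
  \<open>\<langle>\<kappa>(Im a),\<omega>\<rangle>\<close>. If \<open>\<kappa>(b + 2\<pi>\<langle>k,\<omega>\<rangle>) = \<kappa>(b) - 2\<pi>k\<close>, so that resonant eigenvalues are moved to the
  same imaginary part, all these characters are cancelled (\<open>twisted_intertwiner_constant\<close>).

  The same \<open>\<kappa>\<close> has to serve the eigenvalues of \<open>\<sigma>(e\<^sup>t\<^sup>B)\<close>. These are the negative conjugates in the
  unitary case, with unchanged imaginary parts, and any such \<open>\<kappa>\<close> with values in \<open>2\<pi>\<int>\<^sup>d\<close> will do. In the real
  cases the imaginary part changes sign, so \<open>\<kappa>\<close> must be odd. Oddness can be forced by
  antisymmetrising, but then \<open>\<kappa>\<close> takes values only in \<open>\<pi>\<int>\<^sup>d\<close>, and this is where the period \<open>2\<close> comes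
  from (\<open>exists_odd_half_integral_shift\<close>).

  For \<open>SL(n,\<real>)\<close>, once \<open>Z\<close> is real, \<open>det e\<^sup>t\<^sup>B\<close> is a bounded real character of the line and hence
  \<open>1\<close>; then \<open>det Z\<close> is invariant under the dense flow and so constant.
\<close>

section \<open>The matrix exponential as a solution operator\<close>

lemma mat_mult_nth [simp]: "(mat c ** M) $ i $ j = c * M $ i $ j" for M :: "complex^'n^'m"
proof -
  have "(mat c ** M) $ i $ j = (\<Sum>k\<in>UNIV. if i = k then c * M $ k $ j else 0)"
    unfolding matrix_matrix_mult_def mat_def vec_lambda_beta
    by (rule sum.cong) auto
  then show ?thesis by simp
qed

lemma mult_mat_nth [simp]: "(M ** mat c) $ i $ j = c * M $ i $ j" for M :: "complex^'n^'m"
proof -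
  have "(M ** mat c) $ i $ j = (\<Sum>k\<in>UNIV. if k = j then c * M $ i $ k else 0)"
    unfolding matrix_matrix_mult_def mat_def vec_lambda_beta
    by (rule sum.cong) auto
  then show ?thesis by simp
qed

text \<open>Complex scalars enter below as scalar matrices \<open>mat c\<close>, so that they take part in associativity
  arguments.\<close>
lemma mat_commute: "mat c ** M = M ** mat c" for M :: "complex^'n^'n"
  by (simp add: vec_eq_iff)

lemma mat_mult_mat: "mat a ** mat b = (mat (a * b) :: complex^'n^'n)"
  by (simp add: vec_eq_iff) (simp add: mat_def)

lemma mat_add: "mat (a + b) = (mat a + mat b :: complex^'n^'n)"
  by (simp add: vec_eq_iff mat_def)

lemma mat_diff: "mat (a - b) = (mat a - mat b :: complex^'n^'n)"
  by (simp add: vec_eq_iff mat_def)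

lemma scaleR_eq_mat_mult: "r *\<^sub>R M = mat (of_real r) ** M" for M :: "complex^'n^'m"
  by (simp add: vec_eq_iff scaleR_conv_of_real[where 'a=complex, symmetric])

lemma bounded_bilinear_matrix_mult:
  "bounded_bilinear ((**) :: complex^'n^'m \<Rightarrow> complex^'k^'n \<Rightarrow> complex^'k^'m)"
proof (subst bilinear_conv_bounded_bilinear[symmetric], unfold bilinear_def, intro conjI allI)
  fix A :: "complex^'n^'m" show "linear ((**) A :: complex^'k^'n \<Rightarrow> _)"
    by (rule linearI) (simp_all add: vec_eq_iff matrix_matrix_mult_def sum.distrib
        algebra_simps scaleR_sum_right)
next
  fix A :: "complex^'k^'n" show "linear (\<lambda>M :: complex^'n^'m. M ** A)"
    by (rule linearI) (simp_all add: vec_eq_iff matrix_matrix_mult_def sum.distrib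
        algebra_simps scaleR_sum_right)
qed

interpretation matmul: bounded_bilinear "(**) :: complex^'n^'m \<Rightarrow> complex^'k^'n \<Rightarrow> complex^'k^'m"
  by (rule bounded_bilinear_matrix_mult)

lemma has_vector_derivative_vecI:
  fixes f :: "real \<Rightarrow> ('a::real_normed_vector)^'n"
  assumes "\<And>i. ((\<lambda>t. f t $ i) has_vector_derivative D $ i) (at x)"
  shows "(f has_vector_derivative D) (at x)"
  using assms unfolding has_vector_derivative_def has_derivative_def
  by (auto intro!: vec_tendstoI bounded_linear_scaleR_left)

lemma funpow_scaleR_mult:
  "((**) (t *\<^sub>R A) ^^ k) M = t ^ k *\<^sub>R ((**) A ^^ k) M" for A :: "complex^'n^'n" and M :: "complex^'k^'n"
  by (induction k) (simp_all add: matmul.scaleR_left matmul.scaleR_right)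

lemma summable_mexp: "summable (\<lambda>k. (1 / fact k) *\<^sub>R ((**) A ^^ k) (mat 1))" for A :: "complex^'n^'n"
proof -
  obtain K where K: "\<And>M :: complex^'n^'n. norm (A ** M) \<le> norm M * K" "0 < K"
    using bounded_linear.pos_bounded[OF matmul.bounded_linear_right] by blast
  have b: "norm (((**) A ^^ k) (mat 1 :: complex^'n^'n)) \<le> norm (mat 1 :: complex^'n^'n) * K ^ k" for k
  proof (induction k)
    case (Suc k)
    have "norm (((**) A ^^ Suc k) (mat 1 :: complex^'n^'n)) \<le> norm (((**) A ^^ k) (mat 1 :: complex^'n^'n)) * K"
      using K(1) by simp
    also have "\<dots> \<le> (norm (mat 1 :: complex^'n^'n) * K ^ k) * K"
      using Suc K(2) by (intro mult_right_mono) auto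
    finally show ?case by (simp add: mult_ac)
  qed simp
  have "summable (\<lambda>k. norm (mat 1 :: complex^'n^'n) * (inverse (fact k) * K ^ k))"
    using summable_exp[of K] by (rule summable_mult)
  then show ?thesis
  proof (rule summable_comparison_test'[where N = 0])
    fix k
    show "norm ((1 / fact k) *\<^sub>R ((**) A ^^ k) (mat 1)) \<le> norm (mat 1 :: complex^'n^'n) * (inverse (fact k) * K ^ k)"
      using b[of k] by (simp add: field_simps divide_right_mono)
  qed
qed

lemma mexp_nth_sums:
  "(\<lambda>k. (((**) A ^^ k) (mat 1)) $ i $ j / fact k * of_real t ^ k) sums (mexp (t *\<^sub>R A) $ i $ j)"
  for A :: "complex^'n^'n"
proof -
  have "(\<lambda>k. (1 / fact k) *\<^sub>R ((**) (t *\<^sub>R A) ^^ k) (mat 1)) sums mexp (t *\<^sub>R A)"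
    unfolding mexp_def by (rule summable_sums[OF summable_mexp])
  then have "(\<lambda>k. ((1 / fact k) *\<^sub>R ((**) (t *\<^sub>R A) ^^ k) (mat 1)) $ i $ j) sums (mexp (t *\<^sub>R A) $ i $ j)"
    by (intro bounded_linear.sums[OF bounded_linear_vec_nth])
  moreover have "((1 / fact k) *\<^sub>R ((**) (t *\<^sub>R A) ^^ k) (mat 1)) $ i $ j = 
     (((**) A ^^ k) (mat 1)) $ i $ j / fact k * of_real t ^ k" for k
    by (simp add: funpow_scaleR_mult scaleR_conv_of_real[where 'a=complex])
  ultimately show ?thesis by simp
qed

text \<open>Each entry of \<open>e\<^sup>t\<^sup>A\<close> is an everywhere convergent power series in \<open>t\<close>, so it can be
  differentiated term by term; multiplication by \<open>A\<close> is the shift of the coefficients.\<close>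
lemma has_vector_derivative_mexp:
  "((\<lambda>t. mexp (t *\<^sub>R A)) has_vector_derivative A ** mexp (t *\<^sub>R A)) (at t)" for A :: "complex^'n^'n"
proof (intro has_vector_derivative_vecI)
  fix i j
  define c where "c i k = (((**) A ^^ k) (mat 1)) $ i $ j / fact k" for i k
  have *: "(\<lambda>k. c i k * of_real t ^ k) sums (mexp (t *\<^sub>R A) $ i $ j)" for i t
    unfolding c_def by (rule mexp_nth_sums)
  have sm: "summable (\<lambda>k. c i k * y ^ k)" for y
  proof (rule powser_inside)
    show "summable (\<lambda>n. c i n * complex_of_real (norm y + 1) ^ n)"
      using *[of i "norm y + 1"] sums_summable by blast
    show "norm y < norm (complex_of_real (norm y + 1))" by (force simp del: of_real_add)
  qed
  have d: "diffs (c i) k * of_real t ^ k = (\<Sum>l\<in>UNIV. A $ i $ l * (c l k * of_real t ^ k))" for k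
  proof -
    have "diffs (c i) k = (of_nat (Suc k) * (\<Sum>l\<in>UNIV. A $ i $ l * (((**) A ^^ k) (mat 1)) $ l $ j)) / (of_nat (Suc k) * fact k)"
      by (simp add: diffs_def c_def matrix_matrix_mult_def)
    also have "\<dots> = (\<Sum>l\<in>UNIV. A $ i $ l * c l k)"
      by (simp add: c_def sum_divide_distrib del: of_nat_Suc)
    finally show ?thesis by (simp add: sum_distrib_left mult_ac)
  qed
  have "(\<lambda>k. diffs (c i) k * of_real t ^ k) sums (\<Sum>l\<in>UNIV. A $ i $ l * mexp (t *\<^sub>R A) $ l $ j)"
    unfolding d by (intro sums_sum sums_mult *)
  then have e: "(\<Sum>k. diffs (c i) k * of_real t ^ k) = (A ** mexp (t *\<^sub>R A)) $ i $ j"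
    by (simp add: sums_iff matrix_matrix_mult_def)
  have "((\<lambda>x. \<Sum>k. c i k * x ^ k) has_field_derivative (A ** mexp (t *\<^sub>R A)) $ i $ j) (at (of_real t))"
    using termdiffs_strong_converges_everywhere[OF sm, where x="of_real t"] e by simp
  from has_vector_derivative_real_field[OF this]
  show "((\<lambda>t. mexp (t *\<^sub>R A) $ i $ j) has_vector_derivative (A ** mexp (t *\<^sub>R A)) $ i $ j) (at t)"
    using * by (simp add: sums_iff)
qed

lemma mexp_0 [simp]: "mexp (0 :: complex^'n^'n) = mat 1"
proof -
  have "((**) 0 ^^ k) (mat 1) = (0 :: complex^'n^'n)" if k: "k \<notin> {0}" for k
    using k by (cases k) (simp_all add: matmul.zero_left)
  then have "(\<lambda>k. (1 / fact k) *\<^sub>R ((**) (0 :: complex^'n^'n) ^^ k) (mat 1 :: complex^'n^'n)) sums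
      (\<Sum>k\<in>{0}. (1 / fact k) *\<^sub>R ((**) 0 ^^ k) (mat 1))"
    by (intro sums_finite) simp_all
  then show ?thesis unfolding mexp_def by (simp add: sums_iff)
qed

lemma mexp_commute:
  fixes A M :: "complex^'n^'n"
  assumes "A ** M = M ** A"
  shows "mexp A ** M = M ** mexp A"
proof -
  have p: "((**) A ^^ k) (mat 1) ** M = M ** ((**) A ^^ k) (mat 1)" for k
  proof (induction k)
    case (Suc k)
    then show ?case using assms by simp (metis matrix_mul_assoc)
  qed simp
  have "mexp A ** M = (\<Sum>k. ((1 / fact k) *\<^sub>R ((**) A ^^ k) (mat 1)) ** M)"
    unfolding mexp_def by (rule bounded_linear.suminf[OF matmul.bounded_linear_left summable_mexp])
  also have "\<dots> = (\<Sum>k. M ** ((1 / fact k) *\<^sub>R ((**) A ^^ k) (mat 1)))"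
    by (simp add: matmul.scaleR_left matmul.scaleR_right p)
  also have "\<dots> = M ** mexp A"
    unfolding mexp_def by (rule bounded_linear.suminf[OF matmul.bounded_linear_right summable_mexp, symmetric])
  finally show ?thesis .
qed

text \<open>The product rule and the commutation of \<open>A\<close> with \<open>e\<^sup>-\<^sup>t\<^sup>A\<close> give the left side derivative zero.\<close>
lemma mexp_minus_mult_solution:
  fixes A :: "complex^'n^'n" and Y :: "real \<Rightarrow> complex^'n^'n"
  assumes "\<And>t. (Y has_vector_derivative A ** Y t) (at t)"
  shows "mexp (- t *\<^sub>R A) ** Y t = Y 0"
proof -
  have m: "((\<lambda>t. mexp (- t *\<^sub>R A)) has_vector_derivative (- 1) *\<^sub>R (A ** mexp (- t *\<^sub>R A))) (at t)" for t
  proof -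
    have "(uminus has_vector_derivative - 1) (at t)"
      by (auto intro!: derivative_eq_intros)
    from vector_diff_chain_at[OF this has_vector_derivative_mexp[of A "- t"]] show ?thesis
      by (simp add: o_def)
  qed
  have "A ** mexp (- t *\<^sub>R A) = mexp (- t *\<^sub>R A) ** A" for t
    by (rule mexp_commute[symmetric]) (simp add: matmul.scaleR_left matmul.scaleR_right matmul.minus_left matmul.minus_right)
  then have "((\<lambda>t. mexp (- t *\<^sub>R A) ** Y t) has_vector_derivative 0) (at t)" for t
    using matmul.has_vector_derivative[OF m assms, of t] 
    by (simp add: matmul.minus_left matrix_mul_assoc)
  then have "\<And>t. ((\<lambda>t. mexp (- t *\<^sub>R A) ** Y t) has_derivative (\<lambda>_. 0)) (at t)"
    by (simp add: has_vector_derivative_def)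
  then obtain c where c: "\<And>t. mexp (- t *\<^sub>R A) ** Y t = c"
    using has_derivative_zero_constant[of UNIV "\<lambda>t. mexp (- t *\<^sub>R A) ** Y t"] by auto
  show ?thesis using c[of t] c[of 0] by simp
qed

lemma mexp_minus: "mexp (- t *\<^sub>R A) ** mexp (t *\<^sub>R A) = mat 1" for A :: "complex^'n^'n"
  using mexp_minus_mult_solution[OF has_vector_derivative_mexp, of t A] by simp

text \<open>Later identities between exponentials are obtained from this uniqueness: it is enough to
  differentiate both sides.\<close>
lemma mexp_solves_uniquely:
  fixes A :: "complex^'n^'n" and Y :: "real \<Rightarrow> complex^'n^'n"
  assumes "\<And>t. (Y has_vector_derivative A ** Y t) (at t)"
  shows "Y t = mexp (t *\<^sub>R A) ** Y 0"
  using mexp_minus_mult_solution[OF assms, of t] mexp_minus[of "-t" A]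
  by simp (metis matrix_mul_assoc matrix_mul_lid)

lemma mexp_add: "mexp ((s + t) *\<^sub>R A) = mexp (s *\<^sub>R A) ** mexp (t *\<^sub>R A)" for A :: "complex^'n^'n"
proof -
  have "((\<lambda>s. mexp ((s + t) *\<^sub>R A)) has_vector_derivative A ** mexp ((s + t) *\<^sub>R A)) (at s)" for s
  proof -
    have "((\<lambda>s. s + t) has_vector_derivative 1) (at s)"
      by (auto intro!: derivative_eq_intros)
    from vector_diff_chain_at[OF this has_vector_derivative_mexp[of A "s + t"]] show ?thesis
      by (simp add: o_def)
  qed
  from mexp_solves_uniquely[of "\<lambda>s. mexp ((s + t) *\<^sub>R A)" A s] this show ?thesis by simp
qed

section \<open>Spectral decomposition of a complex matrix\<close>

text \<open>\<open>N + c\<close> is invertible where \<open>N\<close> is nilpotent. The solution is a polynomial in \<open>N\<close> applied to \<open>P\<close>;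
  the commutation clause records just as much of this as later arguments need.\<close>
lemma nilpotent_shift_solvable:
  fixes N P :: "complex^'n^'n"
  assumes "c \<noteq> 0" "((**) N ^^ m) P = 0"
  shows "\<exists>R. (N + mat c) ** R = P \<and> ((**) N ^^ m) R = 0 \<and>
    (\<forall>D. N ** D = D ** N \<and> P ** D = D ** P \<longrightarrow> R ** D = D ** R)"
  using assms(2)
proof (induction m arbitrary: P)
  case 0
  then show ?case by (intro exI[of _ 0]) (simp add: matmul.zero_left matmul.zero_right)
next
  case (Suc m)
  have "((**) N ^^ m) (N ** P) = 0"
    using Suc.prems by (simp add: funpow_swap1)
  from Suc.IH[OF this] obtain R where R: "(N + mat c) ** R = N ** P" "((**) N ^^ m) R = 0"
    "\<And>D. N ** D = D ** N \<Longrightarrow> (N ** P) ** D = D ** (N ** P) \<Longrightarrow> R ** D = D ** R"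
    by blast
  \<comment> \<open>Since \<open>(N + c)R = NP\<close>, the difference \<open>P - R\<close> is mapped by \<open>N + c\<close> to \<open>cP\<close>.\<close>
  define S where "S = mat (1 / c) ** (P - R)"
  have lin: "((**) N ^^ k) (mat a ** (X - Y)) = mat a ** (((**) N ^^ k) X - ((**) N ^^ k) Y)" for k a X Y
  proof (induction k)
    case (Suc k)
    then show ?case
      by (simp add: matmul.diff_right matrix_mul_assoc mat_commute[of a, symmetric])
  qed (simp add: matmul.diff_right)
  have "(N + mat c) ** S = mat (1 / c) ** ((N + mat c) ** P - (N + mat c) ** R)"
    using lin[of 1] unfolding S_def
    by (metis mat_commute matmul.diff_right matrix_mul_assoc)
  also have "\<dots> = mat (1 / c) ** (mat c ** P)"
    by (simp add: R(1) matmul.add_left[of N "mat c" P])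
  also have "\<dots> = P"
    using \<open>c \<noteq> 0\<close> by (simp add: matrix_mul_assoc mat_mult_mat)
  finally have 1: "(N + mat c) ** S = P" .
  have 2: "((**) N ^^ Suc m) S = 0"
    unfolding S_def lin using Suc.prems R(2) by (simp add: matmul.zero_right)
  have 3: "S ** D = D ** S" if "N ** D = D ** N" "P ** D = D ** P" for D
  proof -
    have "R ** D = D ** R"
      using that by (intro R(3)) (simp_all, metis matrix_mul_assoc)
    with that have "(P - R) ** D = D ** (P - R)"
      by (simp add: matmul.diff_left matmul.diff_right)
    then show ?thesis
      unfolding S_def by (metis mat_commute matrix_mul_assoc)
  qed
  show ?case using 1 2 3 by blast
qed

text \<open>On a vector killed by \<open>N + c\<close> the nilpotent \<open>N\<close> acts as the invertible scalar \<open>-c\<close>. This makes the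
  primary components for different eigenvalues independent.\<close>
lemma nilpotent_shift_injective:
  fixes N Q :: "complex^'n^'n"
  assumes "c \<noteq> 0" "((**) N ^^ m) Q = 0" "((**) (N + mat c) ^^ l) Q = 0"
  shows "Q = 0"
  using assms(2,3)
proof (induction l arbitrary: Q)
  case (Suc l)
  have com: "((**) N ^^ k) ((N + mat c) ** Q) = (N + mat c) ** (((**) N ^^ k) Q)" for k
  proof (induction k)
    case (Suc k)
    have "N ** (N + mat c) = (N + mat c) ** N"
      by (simp add: matmul.add_left matmul.add_right mat_commute)
    with Suc show ?case by simp (metis matrix_mul_assoc)
  qed simp
  have "(N + mat c) ** Q = 0"
  proof (rule Suc.IH)
    show "((**) N ^^ m) ((N + mat c) ** Q) = 0"
      using Suc.prems(1) com[of m] by (simp add: matmul.zero_right)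
    show "((**) (N + mat c) ^^ l) ((N + mat c) ** Q) = 0"
      using Suc.prems(2) by (simp add: funpow_swap1)
  qed
  then have NQ: "N ** Q = mat (- c) ** Q"
    by (simp add: matmul.add_left mat_diff[of 0, simplified] matmul.minus_left eq_neg_iff_add_eq_0)
  have "((**) N ^^ k) Q = mat ((- c) ^ k) ** Q" for k
  proof (induction k)
    case (Suc k)
    have "N ** (mat ((- c) ^ k) ** Q) = mat ((- c) ^ k) ** (N ** Q)"
      by (metis mat_commute matrix_mul_assoc)
    with Suc show ?case by (simp add: NQ matrix_mul_assoc mat_mult_mat mult.commute)
  qed simp
  with Suc.prems have "mat ((- c) ^ m) ** Q = 0" by simp
  then have "mat (1 / (- c) ^ m) ** (mat ((- c) ^ m) ** Q) = 0"
    by (simp add: matmul.zero_right)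
  then show ?case using \<open>c \<noteq> 0\<close> by (simp add: matrix_mul_assoc mat_mult_mat)
qed simp

text \<open>Induction on the list of roots. The factor \<open>B - a\<close> is invertible on the components for the
  other roots, so these can be lifted through it one by one; what remains of \<open>C\<close> is a
  component for \<open>a\<close> whose nilpotency order has grown by at most one.\<close>
lemma primary_decomposition:
  fixes B C :: "complex^'n^'n"
  assumes "foldl (\<lambda>M a. (B - mat a) ** M) C as = 0"
  shows "\<exists>P m. C = (\<Sum>a\<in>set as. P a) \<and> (\<forall>a\<in>set as. ((**) (B - mat a) ^^ m) (P a) = 0 \<and>
    (\<forall>D. B ** D = D ** B \<and> C ** D = D ** C \<longrightarrow> P a ** D = D ** P a))"
  using assms
proof (induction as arbitrary: C)
  case (Cons a as)
  let ?C = "(B - mat a) ** C" and ?S = "set as - {a}"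
  from Cons.prems have "foldl (\<lambda>M a. (B - mat a) ** M) ?C as = 0" by simp
  from Cons.IH[OF this] obtain P m where P: "?C = (\<Sum>a\<in>set as. P a)"
    "\<And>b. b \<in> set as \<Longrightarrow> ((**) (B - mat b) ^^ m) (P b) = 0"
    "\<And>b D. b \<in> set as \<Longrightarrow> B ** D = D ** B \<Longrightarrow> ?C ** D = D ** ?C \<Longrightarrow> P b ** D = D ** P b"
    by blast
  have "\<exists>R. (B - mat a) ** R = P b \<and> ((**) (B - mat b) ^^ m) R = 0 \<and>
    (\<forall>D. (B - mat b) ** D = D ** (B - mat b) \<and> P b ** D = D ** P b \<longrightarrow> R ** D = D ** R)"
    if "b \<in> ?S" for b
    using nilpotent_shift_solvable[where c = "b - a" and N = "B - mat b" and m = m and P = "P b"] P(2)[of b] that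
    by (simp add: mat_diff)
  then obtain R where R: "\<And>b. b \<in> ?S \<Longrightarrow> (B - mat a) ** R b = P b"
    "\<And>b. b \<in> ?S \<Longrightarrow> ((**) (B - mat b) ^^ m) (R b) = 0"
    "\<And>b D. b \<in> ?S \<Longrightarrow> (B - mat b) ** D = D ** (B - mat b) \<Longrightarrow> P b ** D = D ** P b \<Longrightarrow> R b ** D = D ** R b"
    by metis
  define Q where "Q b = (if b = a then C - (\<Sum>b\<in>?S. R b) else R b)" for b
  have sumQ: "C = (\<Sum>b\<in>set (a # as). Q b)"
  proof -
    have "set (a # as) = insert a ?S" by auto
    moreover have "(\<Sum>b\<in>?S. Q b) = (\<Sum>b\<in>?S. R b)" by (rule sum.cong) (auto simp: Q_def)
    ultimately show ?thesis by (simp add: sum.insert_remove Q_def)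
  qed
  have Qa: "(B - mat a) ** Q a = (if a \<in> set as then P a else 0)"
  proof -
    have "(B - mat a) ** Q a = ?C - (\<Sum>b\<in>?S. P b)"
      by (simp add: Q_def matmul.diff_right matmul.sum_right R(1))
    also have "\<dots> = (if a \<in> set as then P a else 0)"
      unfolding P(1) by (simp add: sum_diff1)
    finally show ?thesis .
  qed
  have nil: "((**) (B - mat b) ^^ Suc m) (Q b) = 0" if "b \<in> set (a # as)" for b
  proof (cases "b = a")
    case True
    have z: "((**) (B - mat a) ^^ m) 0 = (0 :: complex^'n^'n)" by (induction m) (simp_all add: matmul.zero_right)
    show ?thesis
      unfolding funpow_Suc_right o_apply True Qa using P(2)[of a] z by auto
  next
    case False
    then show ?thesis using R(2)[of b] that by (simp add: Q_def matmul.zero_right)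
  qed
  have com: "Q b ** D = D ** Q b" if D: "B ** D = D ** B" "C ** D = D ** C" and b: "b \<in> set (a # as)" for b D
  proof -
    have BD: "(B - mat c) ** D = D ** (B - mat c)" for c
      using D(1) by (simp add: matmul.diff_left matmul.diff_right mat_commute)
    have "?C ** D = D ** ?C" using BD[of a] D(2) by (metis matrix_mul_assoc)
    then have PD: "P b ** D = D ** P b" if "b \<in> set as" for b using P(3) D(1) that by blast
    then have RD: "R b ** D = D ** R b" if "b \<in> ?S" for b using R(3) BD that by blast
    then show ?thesis
      using b D(2) by (auto simp: Q_def matmul.diff_left matmul.diff_right matmul.sum_left matmul.sum_right)
  qed
  show ?case using sumQ nil com by blast
qed simp

text \<open>The value \<open>p(B) C\<close>.\<close>
definition poly_act :: "complex^'n^'n \<Rightarrow> complex^'n^'n \<Rightarrow> complex poly \<Rightarrow> complex^'n^'n" where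
  "poly_act B C p = fold_coeffs (\<lambda>a M. mat a ** C + B ** M) p 0"

lemma poly_act_0 [simp]: "poly_act B C 0 = 0"
  by (simp add: poly_act_def)

lemma poly_act_pCons [simp]: "poly_act B C (pCons a p) = mat a ** C + B ** poly_act B C p"
  by (cases "p = 0 \<and> a = 0")
     (auto simp: poly_act_def matmul.zero_left matmul.zero_right fold_coeffs_pCons_coeff_not_0_eq fold_coeffs_pCons_not_0_0_eq)

lemma poly_act_add: "poly_act B C (p + q) = poly_act B C p + poly_act B C q"
  by (induction p q rule: poly_induct2) (simp_all add: mat_add matmul.add_left matmul.add_right)

lemma poly_act_smult: "poly_act B C (smult c p) = mat c ** poly_act B C p"
proof (induction p)
  case (pCons a p)
  have "B ** (mat c ** M) = mat c ** (B ** M)" for M :: "complex^'a^'a"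
    by (metis mat_commute matrix_mul_assoc)
  with pCons show ?case by (simp add: matmul.add_right matrix_mul_assoc mat_mult_mat)
qed (simp add: matmul.zero_right)

lemma poly_act_sum: "poly_act B C (\<Sum>i\<in>I. f i) = (\<Sum>i\<in>I. poly_act B C (f i))"
  by (induction I rule: infinite_finite_induct) (simp_all add: poly_act_add)

lemma poly_act_monom: "poly_act B C (monom c k) = mat c ** ((**) B ^^ k) C"
proof (induction k)
  case (Suc k)
  then show ?case
    by (simp add: monom_Suc matmul.zero_left) (metis mat_commute matrix_mul_assoc)
qed (simp add: monom_0 matmul.zero_right)

lemma poly_act_linear_factor:
  fixes B C :: "complex^'n^'n"
  shows "poly_act B C ([:-a, 1:] * p) = poly_act B ((B - mat a) ** C) p"
proof -
  have "poly_act B ((B - mat a) ** C) p = (B - mat a) ** poly_act B C p"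
  proof (induction p)
    case (pCons c p)
    have "mat c ** ((B - mat a) ** C) = (B - mat a) ** (mat c ** C)"
      "B ** (B - mat a) = (B - mat a) ** B"
      by (metis mat_commute matrix_mul_assoc)
         (simp add: matmul.diff_left matmul.diff_right mat_commute)
    then show ?case using pCons by (simp add: matmul.add_right) (metis matrix_mul_assoc)
  qed (simp add: matmul.zero_right)
  moreover have "[:-a, 1:] * p = smult (- a) p + pCons 0 p" by simp
  moreover have "mat (- a) = (- mat a :: complex^'n^'n)" by (simp add: vec_eq_iff mat_def)
  ultimately show ?thesis
    by (simp only: poly_act_add poly_act_smult poly_act_pCons matmul.diff_left matmul.minus_left
        mat_0 matmul.zero_left add_0_left uminus_add_conv_diff)
qed

text \<open>Indexing by a sequence, and not by its range, covers repeated vectors as well.\<close>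
lemma linear_dependence_of_sequence:
  fixes v :: "nat \<Rightarrow> 'a::euclidean_space"
  obtains c n where "\<exists>k\<le>n. c k \<noteq> 0" "(\<Sum>k\<le>n. c k *\<^sub>R v k) = 0"
proof (cases "inj_on v {..DIM('a)}")
  case True
  then have "card (v ` {..DIM('a)}) > DIM('a)" by (simp add: card_image)
  then have "dependent (v ` {..DIM('a)})" using independent_bound[of "v ` {..DIM('a)}"] by auto
  then obtain u where "\<exists>x\<in>v ` {..DIM('a)}. u x \<noteq> 0" "(\<Sum>x\<in>v ` {..DIM('a)}. u x *\<^sub>R x) = 0"
    by (auto simp: dependent_finite)
  then show ?thesis using True that[of "DIM('a)" "u \<circ> v"] by (auto simp: sum.reindex)
next
  case False
  then obtain i j where ij: "i \<le> DIM('a)" "j \<le> DIM('a)" "i \<noteq> j" "v i = v j" by (auto simp: inj_on_def)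
  define c where "c k = (if k = i then 1 else 0) - (if k = j then 1 else 0 :: real)" for k
  have "(\<Sum>k\<le>DIM('a). c k *\<^sub>R v k) =
      (\<Sum>k\<le>DIM('a). if k = i then v k else 0) - (\<Sum>k\<le>DIM('a). if k = j then v k else 0)"
    unfolding sum_subtractf[symmetric] by (rule sum.cong) (auto simp: c_def)
  also have "\<dots> = 0" using ij by simp
  finally have "(\<Sum>k\<le>DIM('a). c k *\<^sub>R v k) = 0" .
  moreover have "c i \<noteq> 0" using ij by (simp add: c_def)
  ultimately show ?thesis using that[of "DIM('a)" c] ij(1) by blast
qed

text \<open>The powers of \<open>B\<close> are linearly dependent, so some nonzero polynomial annihilates \<open>B\<close>, and by
  the fundamental theorem of algebra its linear factors can be split off one at a time.\<close>
lemma exists_annihilating_product: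
  fixes B :: "complex^'n^'n"
  shows "\<exists>as. foldl (\<lambda>M a. (B - mat a) ** M) (mat 1) as = 0"
proof -
  have factor: "\<exists>as. foldl (\<lambda>M a. (B - mat a) ** M) C as = 0"
    if "p \<noteq> 0" "poly_act B C p = 0" for p C
    using that
  proof (induction "degree p" arbitrary: p C)
    case 0
    then obtain c where "p = [:c:]" "c \<noteq> 0" by (metis degree_eq_zeroE pCons_0_0)
    then have "mat (1 / c) ** (mat c ** C) = 0" "c \<noteq> 0" using 0 by (simp_all add: matmul.zero_right)
    then have "C = 0" by (simp add: matrix_mul_assoc mat_mult_mat)
    then show ?case by (intro exI[of _ "[]"]) simp
  next
    case (Suc n)
    then have "\<not> constant (poly p)" by (simp add: constant_degree)
    then obtain a where "poly p a = 0" using fundamental_theorem_of_algebra by blast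
    then obtain q where q: "p = [:-a, 1:] * q" by (meson dvdE poly_eq_0_iff_dvd)
    with Suc.prems have "q \<noteq> 0" by auto
    then have "degree p = Suc (degree q)" unfolding q by (subst degree_mult_eq) auto
    then obtain as where "foldl (\<lambda>M a. (B - mat a) ** M) ((B - mat a) ** C) as = 0"
      using Suc.hyps(1)[of q "(B - mat a) ** C"] Suc.hyps(2) Suc.prems \<open>q \<noteq> 0\<close>
      by (auto simp: q poly_act_linear_factor[symmetric])
    then show ?case by (intro exI[of _ "a # as"]) simp
  qed
  obtain c n where c: "\<exists>k\<le>n. c k \<noteq> 0" "(\<Sum>k\<le>n. c k *\<^sub>R ((**) B ^^ k) (mat 1)) = 0"
    by (rule linear_dependence_of_sequence)
  define p where "p = (\<Sum>k\<le>n. monom (complex_of_real (c k)) k)"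
  have "coeff p k = complex_of_real (c k)" if "k \<le> n" for k
    using that by (simp add: p_def coeff_sum)
  with c(1) have "p \<noteq> 0" by (metis coeff_0 of_real_eq_0_iff)
  moreover have "poly_act B (mat 1) p = 0"
    using c(2) by (simp add: p_def poly_act_sum poly_act_monom scaleR_eq_mat_mult)
  ultimately show ?thesis using factor by blast
qed

text \<open>Both sides solve \<open>Y' = B Y\<close> with the same initial value. The exponential series of the
  nilpotent part stops after \<open>m\<close> terms, which is where the polynomial in \<open>t\<close> comes from.\<close>
lemma mexp_mult_nilpotent:
  fixes B P :: "complex^'n^'n"
  assumes nil: "((**) (B - mat a) ^^ m) P = 0"
  shows "mexp (t *\<^sub>R B) ** P =
    mat (exp (of_real t * a)) ** (\<Sum>k<m. (t ^ k / fact k) *\<^sub>R ((**) (B - mat a) ^^ k) P)"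
proof -
  let ?N = "B - mat a"
  define V where "V k = ((**) ?N ^^ k) P" for k
  define S where "S t = (\<Sum>k<m. (t ^ k / fact k) *\<^sub>R V k)" for t :: real
  have VS: "V (Suc k) = ?N ** V k" for k by (simp add: V_def)
  have "V m = 0" using nil by (simp add: V_def)
  have dS: "(S has_vector_derivative ?N ** S t) (at t)" for t
  proof -
    have "((\<lambda>t. \<Sum>k<m. (t ^ k / fact k) *\<^sub>R V k) has_vector_derivative
        (\<Sum>k<m. (of_nat k * t ^ (k - 1) / fact k) *\<^sub>R V k)) (at t)"
      by (intro has_vector_derivative_sum)
         (auto intro!: derivative_eq_intros simp: has_real_derivative_iff_has_vector_derivative[symmetric])
    also have "(\<Sum>k<m. (of_nat k * t ^ (k - 1) / fact k) *\<^sub>R V k) = (\<Sum>k<m. (t ^ k / fact k) *\<^sub>R V (Suc k))"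
    proof (cases m)
      case (Suc n)
      have "real (Suc k) * t ^ k / fact (Suc k) = t ^ k / fact k" for k
        by (simp del: of_nat_Suc)
      then have "(\<Sum>k<m. (of_nat k * t ^ (k - 1) / fact k) *\<^sub>R V k) = (\<Sum>k<n. (t ^ k / fact k) *\<^sub>R V (Suc k))"
        unfolding Suc sum.lessThan_Suc_shift by simp
      with Suc \<open>V m = 0\<close> show ?thesis by simp
    qed simp
    also have "\<dots> = ?N ** S t"
      by (simp add: S_def VS matmul.sum_right matmul.scaleR_right)
    finally show ?thesis by (simp add: S_def[abs_def])
  qed
  have "bounded_linear (mat :: complex \<Rightarrow> complex^'n^'n)"
    by (subst linear_conv_bounded_linear[symmetric], rule linearI) (simp_all add: vec_eq_iff mat_def)
  then have dm: "((\<lambda>t. mat (exp (of_real t * a)) :: complex^'n^'n) has_vector_derivative mat (exp (of_real t * a) * a)) (at t)" for t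
    by (rule bounded_linear.has_vector_derivative)
       (auto intro!: has_vector_derivative_real_field derivative_eq_intros)
  have "((\<lambda>t. mat (exp (of_real t * a)) ** S t) has_vector_derivative B ** (mat (exp (of_real t * a)) ** S t)) (at t)" for t
  proof -
    let ?e = "exp (of_real t * a)"
    have "mat ?e ** (?N ** S t) + mat (?e * a) ** S t = mat ?e ** (B ** S t)"
      by (simp add: matmul.diff_left matmul.diff_right matrix_mul_assoc mat_mult_mat)
    also have "\<dots> = B ** (mat ?e ** S t)" by (metis mat_commute matrix_mul_assoc)
    finally show ?thesis using matmul.has_vector_derivative[OF dm dS, of t] by simp
  qed
  from mexp_solves_uniquely[OF this, of t] have "mat (exp (of_real t * a)) ** S t = mexp (t *\<^sub>R B) ** S 0"
    by simp
  moreover have "S 0 = P"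
  proof (cases m)
    case 0
    then show ?thesis using \<open>V m = 0\<close> by (simp add: S_def V_def)
  next
    case (Suc n)
    then show ?thesis by (simp add: S_def sum.lessThan_Suc_shift V_def del: sum.lessThan_Suc)
  qed
  ultimately show ?thesis by (simp add: S_def V_def)
qed

text \<open>Only the form of the time dependence is needed below, not the coefficients.\<close>
definition polynomial_in_time :: "(real \<Rightarrow> complex) \<Rightarrow> bool" where
  "polynomial_in_time f \<longleftrightarrow> (\<exists>p. \<forall>t. f t = poly p (of_real t))"

lemma polynomial_in_time_const: "polynomial_in_time (\<lambda>t. c)"
  unfolding polynomial_in_time_def by (rule exI[of _ "[:c:]"]) simp

lemma polynomial_in_time_power: "polynomial_in_time (\<lambda>t. of_real (t ^ k))"
  unfolding polynomial_in_time_def by (rule exI[of _ "monom 1 k"]) (simp add: poly_monom)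

lemma polynomial_in_time_add:
  "polynomial_in_time f \<Longrightarrow> polynomial_in_time g \<Longrightarrow> polynomial_in_time (\<lambda>t. f t + g t)"
  unfolding polynomial_in_time_def by (metis poly_add)

lemma polynomial_in_time_mult:
  "polynomial_in_time f \<Longrightarrow> polynomial_in_time g \<Longrightarrow> polynomial_in_time (\<lambda>t. f t * g t)"
  unfolding polynomial_in_time_def by (metis poly_mult)

lemma polynomial_in_time_sum:
  "(\<And>i. i \<in> I \<Longrightarrow> polynomial_in_time (f i)) \<Longrightarrow> polynomial_in_time (\<lambda>t. \<Sum>i\<in>I. f i t)"
  by (induction I rule: infinite_finite_induct)
     (auto intro: polynomial_in_time_const polynomial_in_time_add)

lemma polynomial_in_time_cnj: "polynomial_in_time f \<Longrightarrow> polynomial_in_time (\<lambda>t. cnj (f t))"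
  unfolding polynomial_in_time_def by (metis complex_cnj_complex_of_real poly_cnj)

lemma polynomial_in_time_uminus: "polynomial_in_time f \<Longrightarrow> polynomial_in_time (\<lambda>t. f (- t))"
  unfolding polynomial_in_time_def
proof (elim exE)
  fix p assume "\<forall>t. f t = poly p (of_real t)"
  then show "\<exists>p. \<forall>t. f (- t) = poly p (complex_of_real t)"
    by (intro exI[of _ "pcompose p [:0, -1:]"]) (simp add: poly_pcompose)
qed

text \<open>A complete system of mutually annihilating projections \<open>P\<^sub>a\<close> commuting with \<open>E\<close> such that \<open>E(t)P\<^sub>a\<close> is
  \<open>e\<^sup>t\<^sup>e\<^sup>(\<^sup>a\<^sup>)\<close> times a polynomial. The index set is kept apart from the eigenvalues \<open>e(a)\<close> so that
  the families obtained by conjugation and inverse transposition have the same index set.\<close>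
definition spectral_family ::
    "(real \<Rightarrow> complex^'n^'n) \<Rightarrow> 'i set \<Rightarrow> ('i \<Rightarrow> complex) \<Rightarrow> ('i \<Rightarrow> complex^'n^'n) \<Rightarrow> bool" where
  "spectral_family E I e P \<longleftrightarrow> finite I \<and> (\<Sum>a\<in>I. P a) = mat 1 \<and>
    (\<forall>a\<in>I. \<forall>b\<in>I. P a ** P b = (if a = b then P a else 0)) \<and>
    (\<forall>a\<in>I. (\<forall>t. E t ** P a = P a ** E t) \<and>
       (\<forall>i j. polynomial_in_time (\<lambda>t. exp (- (of_real t * e a)) * (E t ** P a) $ i $ j)))"

lemma spectral_familyD:
  assumes "spectral_family E I e P"
  shows "finite I" "(\<Sum>a\<in>I. P a) = mat 1"
    "\<And>a b. a \<in> I \<Longrightarrow> b \<in> I \<Longrightarrow> P a ** P b = (if a = b then P a else 0)"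
    "\<And>a t. a \<in> I \<Longrightarrow> E t ** P a = P a ** E t"
    "\<And>a i j. a \<in> I \<Longrightarrow> polynomial_in_time (\<lambda>t. exp (- (of_real t * e a)) * (E t ** P a) $ i $ j)"
  using assms unfolding spectral_family_def by blast+

lemma exists_spectral_family:
  fixes B :: "complex^'n^'n"
  obtains I P where "spectral_family (\<lambda>t. mexp (t *\<^sub>R B)) I id P" "\<forall>a\<in>I. B ** P a = P a ** B"
proof -
  obtain as where "foldl (\<lambda>M a. (B - mat a) ** M) (mat 1) as = 0"
    using exists_annihilating_product by blast
  from primary_decomposition[OF this] obtain P m where
    P: "mat 1 = (\<Sum>a\<in>set as. P a)" "\<And>a. a \<in> set as \<Longrightarrow> ((**) (B - mat a) ^^ m) (P a) = 0"
    "\<And>a D. a \<in> set as \<Longrightarrow> B ** D = D ** B \<Longrightarrow> P a ** D = D ** P a"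
    by (metis matrix_mul_lid matrix_mul_rid)
  have BP: "B ** P a = P a ** B" if "a \<in> set as" for a using P(3)[OF that, of B] by simp
  have fm: "((**) M ^^ k) (Q ** R) = (((**) M ^^ k) Q) ** R" for M Q R :: "complex^'n^'n" and k
    by (induction k) (simp_all add: matrix_mul_assoc)
  have orth: "P a ** P b = 0" if ab: "a \<in> set as" "b \<in> set as" "a \<noteq> b" for a b
  proof (rule nilpotent_shift_injective[where N = "B - mat a" and c = "a - b" and m = m and l = m])
    show "a - b \<noteq> 0" using ab by simp
    show "((**) (B - mat a) ^^ m) (P a ** P b) = 0"
      unfolding fm using P(2) ab by (simp add: matmul.zero_left)
    have "P a ** P b = P b ** P a" using P(3)[OF ab(1)] BP[OF ab(2)] by simp
    moreover have "((**) (B - mat b) ^^ m) (P b ** P a) = 0"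
      unfolding fm using P(2) ab by (simp add: matmul.zero_left)
    ultimately show "((**) (B - mat a + mat (a - b)) ^^ m) (P a ** P b) = 0"
      by (simp add: mat_diff)
  qed
  have idem: "P a ** P a = P a" if a: "a \<in> set as" for a
  proof -
    have "P a = P a ** (\<Sum>b\<in>set as. P b)" by (simp add: P(1)[symmetric])
    also have "\<dots> = (\<Sum>b\<in>set as. if b = a then P a ** P a else 0)"
      unfolding matmul.sum_right by (rule sum.cong) (auto simp: orth a)
    finally show ?thesis using a by simp
  qed
  have com: "mexp (t *\<^sub>R B) ** P a = P a ** mexp (t *\<^sub>R B)" if "a \<in> set as" for a t
    by (rule mexp_commute) (simp add: matmul.scaleR_left matmul.scaleR_right BP[OF that])
  have pol: "polynomial_in_time (\<lambda>t. exp (- (of_real t * id a)) * (mexp (t *\<^sub>R B) ** P a) $ i $ j)"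
    if "a \<in> set as" for a i j
  proof -
    have "exp (- (of_real t * a)) * (mexp (t *\<^sub>R B) ** P a) $ i $ j =
        (\<Sum>k<m. of_real (t ^ k) * ((((**) (B - mat a) ^^ k) (P a)) $ i $ j / fact k))" for t
      by (simp add: mexp_mult_nilpotent[OF P(2)[OF that]] exp_minus field_simps
          scaleR_conv_of_real[where 'a=complex])
    then show ?thesis
      unfolding id_apply by (simp only:)
        (intro polynomial_in_time_sum polynomial_in_time_mult polynomial_in_time_power polynomial_in_time_const)
  qed
  have "spectral_family (\<lambda>t. mexp (t *\<^sub>R B)) (set as) id P"
    unfolding spectral_family_def using P(1) orth idem com pol by auto
  then show ?thesis using that BP by blast
qed

section \<open>Functions on the torus along an irrational flow\<close>

lemma torus_periodic_bounded:
  fixes f :: "real^'d \<Rightarrow> 'b::real_normed_vector"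
  assumes "continuous_on UNIV f" "torus_periodic 1 f"
  shows "\<exists>M. \<forall>\<theta>. norm (f \<theta>) \<le> M"
proof -
  have "compact (f ` cbox 0 (\<chi> i. 1))"
    by (intro compact_continuous_image continuous_on_subset[OF assms(1)]) auto
  then obtain M where M: "\<And>y. y \<in> f ` cbox 0 (\<chi> i. 1) \<Longrightarrow> norm y \<le> M"
    using compact_imp_bounded bounded_iff by metis
  have "norm (f \<theta>) \<le> M" for \<theta>
  proof -
    define k where "k = (\<chi> i. - real_of_int \<lfloor>\<theta> $ i\<rfloor>)"
    have "k \<in> int_lattice" by (simp add: k_def int_lattice_def)
    then have "f \<theta> = f (\<theta> + k)" using assms(2) by (simp add: torus_periodic_def)
    moreover have "0 \<le> (\<theta> + k) $ i \<and> (\<theta> + k) $ i \<le> 1" for i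
      by (simp add: k_def) linarith
    then have "\<theta> + k \<in> cbox 0 (\<chi> i. 1)" by (simp add: mem_box_cart)
    ultimately show ?thesis using M by auto
  qed
  then show ?thesis by blast
qed

lemma torus_periodicI:
  fixes f :: "real^'d \<Rightarrow> 'b"
  assumes step: "\<And>i \<theta>. f (\<theta> + axis i 1) = f \<theta>"
  shows "torus_periodic 1 f"
proof -
  have int: "f (\<theta> + of_int n *\<^sub>R axis i 1) = f \<theta>" for n i \<theta>
  proof (induction n rule: int_induct[where k = 0])
    case (step1 n)
    then show ?case using step[of "\<theta> + of_int n *\<^sub>R axis i 1" i] by (simp add: algebra_simps)
  next
    case (step2 n)
    then show ?case using step[of "\<theta> + of_int (n - 1) *\<^sub>R axis i 1" i] by (simp add: algebra_simps)
  qed simp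
  have "f (\<theta> + k) = f \<theta>" if k: "k \<in> int_lattice" for \<theta> k
  proof -
    have "f (\<theta> + (\<Sum>i\<in>J. (k $ i) *\<^sub>R axis i 1)) = f \<theta>" if "finite J" for J
      using that
    proof induction
      case (insert i J)
      obtain n where "k $ i = of_int n" using k by (auto simp: int_lattice_def elim: Ints_cases)
      then show ?case using insert int[of "\<theta> + (\<Sum>i\<in>J. (k $ i) *\<^sub>R axis i 1)" n i]
        by (simp add: add_ac)
    qed simp
    moreover have "k = (\<Sum>i\<in>UNIV. (k $ i) *\<^sub>R axis i 1)"
      by (simp add: vec_eq_iff axis_def if_distrib sum.If_cases cong: if_cong)
    ultimately show ?thesis by (metis finite)
  qed
  then show ?thesis by (simp add: torus_periodic_def)
qed

text \<open>Kronecker's theorem. Its hypothesis concerns the set of coordinates of \<open>\<omega>\<close>, while rational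
  independence of \<open>\<omega>\<close> concerns integer vectors; the two agree because the coordinates are distinct.\<close>
lemma flow_dense:
  fixes \<omega> :: "real^'d"
  assumes "rationally_independent \<omega>" "\<epsilon> > 0"
  shows "\<exists>t. \<exists>k\<in>int_lattice. norm (t *\<^sub>R \<omega> + k - \<alpha>) < \<epsilon>"
proof -
  interpret Modules.module "(\<lambda>r. (*) (real_of_int r))"
    by (simp add: Modules.module.intro distrib_left mult.commute)
  have inj: "i = j" if "\<omega> $ i = \<omega> $ j" for i j
  proof (rule ccontr)
    assume "i \<noteq> j"
    define k :: "real^'d" where "k = axis i 1 - axis j 1"
    have "k $ i = 1" using \<open>i \<noteq> j\<close> by (simp add: k_def axis_def)
    then have "k \<noteq> 0" by auto
    moreover have "k \<in> int_lattice" by (simp add: int_lattice_def k_def axis_def)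
    ultimately have "k \<in> int_lattice - {0}" by simp
    moreover have "k \<bullet> \<omega> = 0" using that by (simp add: k_def inner_diff_left inner_axis')
    ultimately show False using assms(1) by (auto simp: rationally_independent_def)
  qed
  have indep: "independent (range (($) \<omega>))"
  proof
    assume "dependent (range (($) \<omega>))"
    then obtain T u v where T: "finite T" "T \<subseteq> range (($) \<omega>)" "(\<Sum>v\<in>T. real_of_int (u v) * v) = 0"
      and v: "v \<in> T" "u v \<noteq> 0"
      unfolding dependent_explicit by blast
    define k :: "real^'d" where "k = (\<chi> i. if \<omega> $ i \<in> T then of_int (u (\<omega> $ i)) else 0)"
    have "inj_on (($) \<omega>) (($) \<omega> -` T)" using inj by (auto simp: inj_on_def)
    moreover have "($) \<omega> ` (($) \<omega> -` T) = T" using T(2) by auto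
    ultimately have "(\<Sum>v\<in>T. real_of_int (u v) * v) = (\<Sum>i\<in>($) \<omega> -` T. real_of_int (u (\<omega> $ i)) * \<omega> $ i)"
      by (metis (no_types, lifting) o_apply sum.cong sum.reindex)
    also have "\<dots> = k \<bullet> \<omega>"
      unfolding inner_vec_def k_def by (rule sum.mono_neutral_cong_left) auto
    finally have "k \<bullet> \<omega> = 0" using T(3) by simp
    obtain i where "v = \<omega> $ i" using v T(2) by auto
    then have "k $ i \<noteq> 0" using v by (simp add: k_def)
    then have "k \<noteq> 0" by auto
    moreover have "k \<in> int_lattice" by (simp add: int_lattice_def k_def)
    ultimately have "k \<in> int_lattice - {0}" by simp
    with \<open>k \<bullet> \<omega> = 0\<close> show False using assms(1) by (auto simp: rationally_independent_def)
  qed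
  \<comment> \<open>The approximation theorem is indexed by an initial segment of the natural numbers.\<close>
  obtain \<phi> :: "nat \<Rightarrow> 'd" where \<phi>: "bij_betw \<phi> {..<CARD('d)} UNIV"
    using ex_bij_betw_nat_finite[of "UNIV :: 'd set"] by (auto simp: atLeast0LessThan)
  have im: "(\<lambda>n. \<omega> $ \<phi> n) ` {..<CARD('d)} = range (($) \<omega>)"
    using \<phi> by (metis bij_betw_imp_surj_on image_image)
  have "inj_on (\<lambda>n. \<omega> $ \<phi> n) {..<CARD('d)}"
    using \<phi> inj by (auto simp: bij_betw_def inj_on_def)
  moreover have "\<epsilon> / CARD('d) > 0" using assms(2) by simp
  ultimately obtain t h where h: "\<And>n. n < CARD('d) \<Longrightarrow> \<bar>t * \<omega> $ \<phi> n - of_int (h n) - \<alpha> $ \<phi> n\<bar> < \<epsilon> / CARD('d)"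
    using Kronecker_thm_1[of "\<lambda>n. \<omega> $ \<phi> n" "CARD('d)" "\<epsilon> / CARD('d)" "\<lambda>n. \<alpha> $ \<phi> n"] indep im by auto
  define \<psi> where "\<psi> = the_inv_into {..<CARD('d)} \<phi>"
  have \<psi>: "\<phi> (\<psi> i) = i" "\<psi> i < CARD('d)" for i
    using \<phi> f_the_inv_into_f_bij_betw[OF \<phi>] bij_betwE[OF bij_betw_the_inv_into[OF \<phi>]]
    by (auto simp: \<psi>_def)
  define k :: "real^'d" where "k = (\<chi> i. - of_int (h (\<psi> i)))"
  have "norm (t *\<^sub>R \<omega> + k - \<alpha>) \<le> (\<Sum>i\<in>UNIV. \<bar>(t *\<^sub>R \<omega> + k - \<alpha>) $ i\<bar>)"
    by (rule norm_le_l1_cart)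
  also have "\<dots> < (\<Sum>i\<in>(UNIV :: 'd set). \<epsilon> / CARD('d))"
    by (rule sum_strict_mono) (use h[OF \<psi>(2)] in \<open>simp_all add: k_def \<psi>(1)\<close>)
  also have "\<dots> = \<epsilon>" by simp
  finally show ?thesis by (intro exI[of _ t] bexI[of _ k]) (simp_all add: k_def int_lattice_def)
qed

lemma flow_invariant_imp_constant:
  fixes f :: "real^'d \<Rightarrow> 'b::metric_space"
  assumes \<omega>: "rationally_independent \<omega>" and f: "continuous_on UNIV f" "torus_periodic 1 f"
    and inv: "\<And>t \<theta>. f (\<theta> + t *\<^sub>R \<omega>) = f \<theta>"
  shows "f \<theta> = f \<eta>"
proof -
  have "dist (f \<theta>) (f \<eta>) < e" if e: "e > 0" for e
  proof -
    obtain d where d: "d > 0" "\<And>x. dist x \<eta> < d \<Longrightarrow> dist (f x) (f \<eta>) < e"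
      using f(1) e unfolding continuous_on_iff by blast
    obtain t k where k: "k \<in> int_lattice" "norm (t *\<^sub>R \<omega> + k - (\<eta> - \<theta>)) < d"
      using flow_dense[OF \<omega> d(1)] by blast
    have "f \<theta> = f (\<theta> + t *\<^sub>R \<omega> + k)"
      using f(2) k(1) inv[of \<theta> t] by (simp add: torus_periodic_def)
    moreover have "dist (\<theta> + t *\<^sub>R \<omega> + k) \<eta> < d"
      using k(2) by (simp add: dist_norm algebra_simps)
    ultimately show ?thesis using d(2) by simp
  qed
  from this[of "dist (f \<theta>) (f \<eta>)"] show ?thesis by force
qed

text \<open>A nonzero polynomial is bounded away from zero for large arguments, so an exponential with
  \<open>Re \<nu> \<noteq> 0\<close> makes the product unbounded in one of the two time directions.\<close>
lemma bounded_exp_times_polynomial: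
  fixes p :: "complex poly"
  assumes bd: "\<And>t. norm (exp (of_real t * \<nu>) * poly p (of_real t)) \<le> M"
  shows "p = 0 \<or> Re \<nu> = 0 \<and> degree p = 0"
proof (cases "p = 0")
  case False
  obtain a q where p: "p = pCons a q" by (cases p)
  obtain c r where cr: "c > 0" "\<And>z. norm z \<ge> r \<Longrightarrow> norm (poly p z) \<ge> c"
  proof (cases "q = 0")
    case True
    then show ?thesis using False that[of "norm a"] by (simp add: p)
  next
    case False
    then show ?thesis using poly_infinity[OF False, of 1 a] that[of 1] by (auto simp: p)
  qed
  have "Re \<nu> = 0"
  proof (rule ccontr)
    assume nz: "Re \<nu> \<noteq> 0"
    \<comment> \<open>At \<open>\<bar>t\<bar> = T\<close> the inequality \<open>e\<^sup>x > x\<close> already makes the product exceed \<open>M\<close>.\<close>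
    define T where "T = max \<bar>r\<bar> ((M + 1) / (c * \<bar>Re \<nu>\<bar>))"
    define t where "t = sgn (Re \<nu>) * T"
    have t: "t * Re \<nu> = T * \<bar>Re \<nu>\<bar>" by (simp add: t_def abs_sgn mult_ac)
    have "T \<ge> 0" by (simp add: T_def)
    then have "\<bar>t\<bar> = T" using nz by (simp add: t_def abs_mult)
    then have "norm (complex_of_real t) \<ge> r" by (simp add: T_def)
    then have "exp (t * Re \<nu>) * c \<le> norm (exp (of_real t * \<nu>) * poly p (of_real t))"
      using cr(2) by (simp add: norm_mult norm_exp_eq_Re)
    also have "\<dots> \<le> M" by (rule bd)
    finally have "exp (T * \<bar>Re \<nu>\<bar>) * c \<le> M" by (simp add: t)
    moreover have "T * \<bar>Re \<nu>\<bar> < exp (T * \<bar>Re \<nu>\<bar>)"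
      using exp_ge_add_one_self[of "T * \<bar>Re \<nu>\<bar>"] by linarith
    then have "T * \<bar>Re \<nu>\<bar> * c < exp (T * \<bar>Re \<nu>\<bar>) * c" using cr(1) by simp
    moreover have "(M + 1) / (c * \<bar>Re \<nu>\<bar>) \<le> T" by (simp add: T_def)
    then have "M + 1 \<le> T * \<bar>Re \<nu>\<bar> * c" using nz cr(1) by (simp add: field_simps)
    ultimately show False by linarith
  qed
  moreover have "q = 0"
  proof (rule ccontr)
    assume "q \<noteq> 0"
    then obtain r where r: "\<And>z. r \<le> norm z \<Longrightarrow> M + 1 \<le> norm (poly p z)"
      using poly_infinity[of q "M + 1" a] by (auto simp: p)
    have "norm (poly p (of_real \<bar>r\<bar>)) \<le> M"
      using bd[of "\<bar>r\<bar>"] \<open>Re \<nu> = 0\<close> by (simp add: norm_mult norm_exp_eq_Re)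
    moreover have "M + 1 \<le> norm (poly p (of_real \<bar>r\<bar>))"
      by (rule r) (simp only: norm_of_real abs_abs abs_ge_self)
    ultimately show False by linarith
  qed
  ultimately show ?thesis by (simp add: p)
qed simp

lemma continuous_exp_eq_1_imp_constant:
  fixes u :: "'a::real_normed_vector \<Rightarrow> complex"
  assumes "continuous_on UNIV u" "\<And>x. exp (u x) = 1"
  shows "u x = u y"
proof -
  have "u constant_on UNIV"
  proof (rule continuous_discrete_range_constant[OF _ assms(1)])
    have "2 * pi \<le> norm (u y - u x)" if "u y \<noteq> u x" for x y
    proof (rule ccontr)
      assume "\<not> ?thesis"
      then have "\<bar>Im (u y) - Im (u x)\<bar> < 2 * pi" using abs_Im_le_cmod[of "u y - u x"] by simp
      then show False using exp_complex_eqI[of "u y" "u x"] assms(2) that by simp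
    qed
    then show "\<exists>e>0. \<forall>y. y \<in> UNIV \<and> u y \<noteq> u x \<longrightarrow> e \<le> cmod (u y - u x)" for x
      by (intro exI[of _ "2 * pi"]) simp
  qed auto
  then show ?thesis by (auto simp: constant_on_def)
qed

text \<open>The frequency \<open>\<kappa>\<close> is arbitrary; for \<open>\<kappa> \<in> 2\<pi>\<int>\<^sup>d\<close> this is a character of the torus.\<close>
definition plane_wave :: "real^'d \<Rightarrow> real^'d \<Rightarrow> complex" where
  "plane_wave \<kappa> \<theta> = exp (\<i> * of_real (\<kappa> \<bullet> \<theta>))"

text \<open>The modulus of \<open>g\<close> is invariant under the dense flow, so \<open>g\<close> has no zeros and, \<open>\<real>\<^sup>d\<close> being
  contractible, a continuous logarithm \<open>l\<close>. Its increments over the unit vectors are constant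
  multiples of \<open>2\<pi>i\<close>, and they determine the frequency \<open>k\<close>. After subtracting this linear part,
  \<open>l\<close> becomes periodic, hence bounded, while it grows linearly along the flow; so the growth
  rate is zero and the rest is constant.\<close>
lemma flow_eigenfunction_is_char:
  fixes g :: "real^'d \<Rightarrow> complex"
  assumes \<omega>: "rationally_independent \<omega>" and g: "continuous_on UNIV g" "torus_periodic 1 g"
    and eig: "\<And>t \<theta>. g (\<theta> + t *\<^sub>R \<omega>) = exp (of_real t * \<nu>) * g \<theta>"
    and Re: "Re \<nu> = 0" and nz: "g \<theta>\<^sub>0 \<noteq> 0"
  shows "\<exists>k\<in>int_lattice. Im \<nu> = 2 * pi * (k \<bullet> \<omega>) \<and> (\<forall>\<theta>. g \<theta> = plane_wave ((2 * pi) *\<^sub>R k) \<theta> * g 0)"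
proof -
  have "norm (g \<theta>) = norm (g \<theta>\<^sub>0)" for \<theta>
  proof (rule flow_invariant_imp_constant[OF \<omega>, where f = "\<lambda>\<theta>. norm (g \<theta>)"])
    show "continuous_on UNIV (\<lambda>\<theta>. norm (g \<theta>))" by (intro continuous_intros g)
    show "torus_periodic 1 (\<lambda>\<theta>. norm (g \<theta>))" using g(2) by (simp add: torus_periodic_def)
    show "norm (g (\<theta> + t *\<^sub>R \<omega>)) = norm (g \<theta>)" for t \<theta>
      by (simp add: eig norm_mult norm_exp_eq_Re Re)
  qed
  with nz have "g \<theta> \<noteq> 0" for \<theta> by (metis norm_eq_zero)
  then obtain l where l: "continuous_on UNIV l" "\<And>\<theta>. g \<theta> = exp (l \<theta>)"
    using continuous_logarithm_on_contractible[OF g(1)] convex_imp_contractible[OF convex_UNIV]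
    by (metis UNIV_I)
  have ll: "continuous_on S (\<lambda>x. l (h x))" if "continuous_on S h" for h :: "'z::topological_space \<Rightarrow> real^'d" and S
    using continuous_on_compose2[OF l(1) that] by simp
  have "\<exists>m::int. \<forall>\<theta>. l (\<theta> + axis i 1) - l \<theta> = \<i> * of_real (2 * pi * m)" for i
  proof -
    let ?u = "\<lambda>\<theta>. l (\<theta> + axis i 1) - l \<theta>"
    have "axis i 1 \<in> (int_lattice :: (real^'d) set)" by (simp add: int_lattice_def axis_def)
    then have "g (\<theta> + axis i 1) = g \<theta>" for \<theta> using g(2) by (simp add: torus_periodic_def)
    then have e: "exp (?u \<theta>) = 1" for \<theta> by (simp add: exp_diff l(2)[symmetric] \<open>\<And>\<theta>. g \<theta> \<noteq> 0\<close>)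
    have c: "?u \<theta> = ?u 0" for \<theta>
      by (rule continuous_exp_eq_1_imp_constant[OF _ e]) (intro continuous_intros ll)
    obtain m where "Re (?u 0) = 0" "Im (?u 0) = of_int (2 * m) * pi"
      using e[of 0] by (auto simp only: exp_eq_1)
    then have "?u 0 = \<i> * of_real (2 * pi * m)" by (simp add: complex_eq_iff)
    with c show ?thesis by metis
  qed
  then obtain m :: "'d \<Rightarrow> int" where m: "\<And>i \<theta>. l (\<theta> + axis i 1) - l \<theta> = \<i> * of_real (2 * pi * m i)"
    by metis
  define k :: "real^'d" where "k = (\<chi> i. m i)"
  have k: "k \<in> int_lattice" by (simp add: k_def int_lattice_def)
  define h where "h \<theta> = l \<theta> - \<i> * of_real (2 * pi * (k \<bullet> \<theta>))" for \<theta>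
  have hc: "continuous_on UNIV h" unfolding h_def by (intro continuous_intros l)
  have hp: "torus_periodic 1 h"
  proof (rule torus_periodicI)
    fix i \<theta>
    have "k \<bullet> (\<theta> + axis i 1) = k \<bullet> \<theta> + m i" by (simp add: inner_add_right inner_axis k_def)
    then show "h (\<theta> + axis i 1) = h \<theta>" using m[of \<theta> i] by (simp add: h_def algebra_simps)
  qed
  define \<mu> where "\<mu> = \<nu> - \<i> * of_real (2 * pi * (k \<bullet> \<omega>))"
  have hflow: "h (\<theta> + t *\<^sub>R \<omega>) = h \<theta> + of_real t * \<mu>" for \<theta> t
  proof -
    let ?u = "\<lambda>t. l (\<theta> + t *\<^sub>R \<omega>) - l \<theta> - of_real t * \<nu>"
    have e: "exp (?u t) = 1" for t
      by (simp add: exp_diff l(2)[symmetric] eig \<open>\<And>\<theta>. g \<theta> \<noteq> 0\<close>)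
    have "?u t = ?u 0"
      by (rule continuous_exp_eq_1_imp_constant[OF _ e]) (intro continuous_intros ll)
    then show ?thesis by (simp add: h_def \<mu>_def algebra_simps)
  qed
  obtain M where M: "\<And>\<theta>. norm (h \<theta>) \<le> M" using torus_periodic_bounded[OF hc hp] by blast
  have "\<mu> = 0"
  proof (rule ccontr)
    assume "\<mu> \<noteq> 0"
    define t where "t = (2 * M + 1) / norm \<mu>"
    have "norm (of_real t * \<mu>) = norm (h (t *\<^sub>R \<omega>) - h 0)" using hflow[of 0 t] by simp
    also have "\<dots> \<le> 2 * M" using norm_triangle_ineq4[of "h (t *\<^sub>R \<omega>)" "h 0"] M[of 0] M[of "t *\<^sub>R \<omega>"] by linarith
    finally have "\<bar>t\<bar> * norm \<mu> \<le> 2 * M" by (simp add: norm_mult)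
    moreover have "M \<ge> 0" using M[of 0] norm_ge_zero[of "h 0"] by linarith
    then have "\<bar>t\<bar> * norm \<mu> = 2 * M + 1" using \<open>\<mu> \<noteq> 0\<close> by (simp add: t_def)
    ultimately show False by linarith
  qed
  have "g \<theta> = plane_wave ((2 * pi) *\<^sub>R k) \<theta> * g 0" for \<theta>
  proof -
    have "h \<theta> = h 0"
      by (rule flow_invariant_imp_constant[OF \<omega> hc hp]) (simp add: hflow \<open>\<mu> = 0\<close>)
    moreover have "h 0 = l 0" by (simp add: h_def)
    ultimately have "l \<theta> = \<i> * of_real (2 * pi * (k \<bullet> \<theta>)) + l 0"
      unfolding h_def by (metis add.commute diff_add_cancel)
    then show ?thesis by (simp add: l(2) plane_wave_def exp_add)
  qed
  moreover have "Im \<nu> = 2 * pi * (k \<bullet> \<omega>)" using \<open>\<mu> = 0\<close> by (simp add: \<mu>_def complex_eq_iff)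
  ultimately show ?thesis using k by blast
qed

text \<open>Boundedness reduces the polynomial to a constant, so \<open>g\<close> is an eigenfunction of the flow.\<close>
lemma flow_quasi_polynomial_is_char:
  fixes g :: "real^'d \<Rightarrow> complex"
  assumes \<omega>: "rationally_independent \<omega>" and g: "continuous_on UNIV g" "torus_periodic 1 g"
    and pol: "\<And>\<theta>. polynomial_in_time (\<lambda>t. exp (- (of_real t * \<nu>)) * g (\<theta> + t *\<^sub>R \<omega>))"
    and nz: "g \<theta>\<^sub>0 \<noteq> 0"
  shows "\<exists>k\<in>int_lattice. Im \<nu> = 2 * pi * (k \<bullet> \<omega>) \<and> (\<forall>\<theta>. g \<theta> = plane_wave ((2 * pi) *\<^sub>R k) \<theta> * g 0)"
proof -
  obtain M where M: "\<And>\<theta>. norm (g \<theta>) \<le> M" using torus_periodic_bounded[OF g] by blast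
  have "\<exists>p. \<forall>t. g (\<theta> + t *\<^sub>R \<omega>) = exp (of_real t * \<nu>) * poly p (of_real t)" for \<theta>
  proof -
    obtain p where "\<And>t. exp (- (of_real t * \<nu>)) * g (\<theta> + t *\<^sub>R \<omega>) = poly p (of_real t)"
      using pol[of \<theta>] by (auto simp: polynomial_in_time_def)
    then show ?thesis by (intro exI[of _ p]) (simp add: exp_minus field_simps)
  qed
  then obtain p where p: "\<And>\<theta> t. g (\<theta> + t *\<^sub>R \<omega>) = exp (of_real t * \<nu>) * poly (p \<theta>) (of_real t)"
    by metis
  have dich: "p \<theta> = 0 \<or> Re \<nu> = 0 \<and> degree (p \<theta>) = 0" for \<theta>
    by (rule bounded_exp_times_polynomial[where M = M]) (simp add: p[symmetric] M)
  have eig: "g (\<theta> + t *\<^sub>R \<omega>) = exp (of_real t * \<nu>) * g \<theta>" for t \<theta>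
    using dich[of \<theta>] p[of \<theta> t] p[of \<theta> 0] by (auto elim!: degree_eq_zeroE)
  moreover have "Re \<nu> = 0" using dich[of \<theta>\<^sub>0] p[of \<theta>\<^sub>0 0] nz by auto
  ultimately show ?thesis using flow_eigenfunction_is_char[OF \<omega> g] nz by blast
qed

section \<open>Conjugates, inverses and transposes\<close>

definition mat_cnj :: "complex^'n^'m \<Rightarrow> complex^'n^'m" where
  "mat_cnj M = (\<chi> i j. cnj (M $ i $ j))"

lemma mat_cnj_nth [simp]: "mat_cnj M $ i $ j = cnj (M $ i $ j)"
  by (simp add: mat_cnj_def)

lemma mat_cnj_mult: "mat_cnj (M ** N) = mat_cnj M ** mat_cnj N"
  by (simp add: vec_eq_iff matrix_matrix_mult_def)

lemma mat_cnj_sum: "mat_cnj (\<Sum>i\<in>I. f i) = (\<Sum>i\<in>I. mat_cnj (f i))"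
  by (simp add: vec_eq_iff)

lemma mat_cnj_mat [simp]: "mat_cnj (mat c) = mat (cnj c)"
  by (simp add: vec_eq_iff mat_def)

lemma mat_cnj_zero [simp]: "mat_cnj 0 = 0"
  by (simp add: vec_eq_iff)

lemma transpose_sum: "transpose (\<Sum>i\<in>I. f i) = (\<Sum>i\<in>I. transpose (f i))"
  for f :: "'i \<Rightarrow> complex^'n^'m"
  by (simp add: vec_eq_iff transpose_def)

lemma transpose_0 [simp]: "transpose 0 = (0 :: complex^'n^'m)"
  by (simp add: vec_eq_iff transpose_def)

lemma conj_transpose_eq: "conj_transpose M = transpose (mat_cnj M)"
  by (simp add: vec_eq_iff conj_transpose_def transpose_def)

lemma real_entries_iff: "real_entries M \<longleftrightarrow> mat_cnj M = M"
  by (simp add: real_entries_def vec_eq_iff Reals_cnj_iff)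

lemma matrix_inv:
  fixes M :: "complex^'n^'n"
  assumes "invertible M"
  shows "M ** matrix_inv M = mat 1" "matrix_inv M ** M = mat 1"
  using someI_ex[OF assms[unfolded invertible_def]] by (simp_all add: matrix_inv_def)

lemma matrix_inv_eqI:
  fixes M N :: "complex^'n^'n"
  assumes "M ** N = mat 1"
  shows "invertible M" "matrix_inv M = N"
proof -
  show inv: "invertible M" using assms invertible_right_inverse by blast
  show "matrix_inv M = N" using matrix_inv(2)[OF inv] assms by (metis matrix_mul_assoc matrix_mul_lid matrix_mul_rid)
qed

lemma matrix_inv_mult:
  fixes M N :: "complex^'n^'n"
  assumes "invertible M" "invertible N"
  shows "matrix_inv (M ** N) = matrix_inv N ** matrix_inv M"
  by (rule matrix_inv_eqI) (metis assms matrix_inv(1) matrix_mul_assoc matrix_mul_rid)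

lemma invertible_matrix_inv: "invertible M \<Longrightarrow> invertible (matrix_inv M)" for M :: "complex^'n^'n"
  using matrix_inv[of M] by (auto simp: invertible_def)

lemma continuous_on_matrixI:
  fixes f :: "'a::topological_space \<Rightarrow> complex^'n^'m"
  assumes "\<And>i j. continuous_on S (\<lambda>x. f x $ i $ j)"
  shows "continuous_on S f"
proof -
  have "continuous_on S (\<lambda>x. \<chi> i. \<chi> j. f x $ i $ j)"
    by (intro continuous_on_vec_lambda assms)
  then show ?thesis by simp
qed

lemma continuous_on_det:
  fixes f :: "'a::topological_space \<Rightarrow> complex^'n^'n"
  assumes "continuous_on S f"
  shows "continuous_on S (\<lambda>x. det (f x))"
  unfolding det_def by (intro continuous_intros assms)

text \<open>By Cramer's rule the entries of the inverse are quotients of determinants.\<close>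
lemma continuous_on_matrix_inv:
  fixes f :: "'a::topological_space \<Rightarrow> complex^'n^'n"
  assumes f: "continuous_on S f" and inv: "\<And>x. x \<in> S \<Longrightarrow> invertible (f x)"
  shows "continuous_on S (\<lambda>x. matrix_inv (f x))"
proof (rule continuous_on_matrixI)
  fix i j
  define g where "g x = det (\<chi> k l. if l = i then axis j 1 $ k else f x $ k $ l) / det (f x)" for x
  have "matrix_inv (f x) $ i $ j = g x" if "x \<in> S" for x
  proof -
    have "det (f x) \<noteq> 0" using inv[OF that] invertible_det_nz by blast
    moreover have "f x *v (matrix_inv (f x) *v axis j 1) = axis j 1"
      by (simp add: matrix_vector_mul_assoc matrix_inv(1)[OF inv[OF that]])
    ultimately have "matrix_inv (f x) *v axis j 1 =
        (\<chi> i. det (\<chi> k l. if l = i then axis j 1 $ k else f x $ k $ l) / det (f x))"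
      using cramer by blast
    moreover have "(matrix_inv (f x) *v axis j 1) $ i = matrix_inv (f x) $ i $ j"
      by (simp add: matrix_vector_mult_def axis_def if_distrib cong: if_cong)
    ultimately show ?thesis by (simp add: g_def)
  qed
  moreover have "continuous_on S g"
    unfolding g_def
  proof (rule continuous_on_divide)
    show "\<forall>x\<in>S. det (f x) \<noteq> 0" using inv invertible_det_nz by blast
    show "continuous_on S (\<lambda>x. det (f x))" by (rule continuous_on_det[OF f])
    show "continuous_on S (\<lambda>x. det (\<chi> k l. if l = i then axis j 1 $ k else f x $ k $ l))"
    proof (rule continuous_on_det, rule continuous_on_matrixI)
      fix k l
      show "continuous_on S (\<lambda>x. (\<chi> k l. if l = i then axis j 1 $ k else f x $ k $ l) $ k $ l)"
        by (cases "l = i") (auto intro!: continuous_on_const continuous_on_component f)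
    qed
  qed
  ultimately show "continuous_on S (\<lambda>x. matrix_inv (f x) $ i $ j)"
    using continuous_on_cong by (metis (no_types, lifting))
qed

lemma spectral_family_cnj:
  assumes "spectral_family E I e P"
  shows "spectral_family (\<lambda>t. mat_cnj (E t)) I (\<lambda>a. cnj (e a)) (\<lambda>a. mat_cnj (P a))"
proof -
  note sf = spectral_familyD[OF assms]
  have eq: "exp (- (of_real t * cnj (e a))) * (mat_cnj (E t) ** mat_cnj (P a)) $ i $ j =
      cnj (exp (- (of_real t * e a)) * (E t ** P a) $ i $ j)" for t a i j
    by (simp add: mat_cnj_mult[symmetric] exp_cnj)
  show ?thesis
    unfolding spectral_family_def eq
  proof (intro conjI ballI allI)
    show "(\<Sum>a\<in>I. mat_cnj (P a)) = mat 1" by (simp add: mat_cnj_sum[symmetric] sf(2))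
    show "polynomial_in_time (\<lambda>t. cnj (exp (- (of_real t * e a)) * (E t ** P a) $ i $ j))" if "a \<in> I" for a i j
      by (rule polynomial_in_time_cnj[OF sf(5)[OF that]])
  qed (simp_all add: mat_cnj_mult[symmetric] sf if_distrib[of mat_cnj])
qed

text \<open>Replacing \<open>E(t)\<close> by its inverse transpose negates the eigenvalues; for a one-parameter group
  the inverse is \<open>E(-t)\<close>.\<close>
lemma spectral_family_transpose:
  assumes "spectral_family E I e P"
  shows "spectral_family (\<lambda>t. transpose (E (- t))) I (\<lambda>a. - e a) (\<lambda>a. transpose (P a))"
proof -
  note sf = spectral_familyD[OF assms]
  have pol: "polynomial_in_time (\<lambda>t. exp (- (of_real t * - e a)) * (transpose (E (- t)) ** transpose (P a)) $ i $ j)"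
    if "a \<in> I" for a i j
  proof -
    have "exp (- (of_real t * - e a)) * (transpose (E (- t)) ** transpose (P a)) $ i $ j =
        exp (- (of_real (- t) * e a)) * (E (- t) ** P a) $ j $ i" for t
      by (simp add: matrix_transpose_mul[symmetric] sf(4)[OF that]) (simp add: transpose_def)
    then show ?thesis
      using polynomial_in_time_uminus[OF sf(5)[OF that, of j i]] by simp
  qed
  show ?thesis
    unfolding spectral_family_def
  proof (intro conjI ballI allI)
    show "(\<Sum>a\<in>I. transpose (P a)) = mat 1" by (simp add: transpose_sum[symmetric] sf(2))
    show "transpose (P a) ** transpose (P b) = (if a = b then transpose (P a) else 0)"
      if "a \<in> I" "b \<in> I" for a b
      using sf(3)[OF that(2,1)] by (simp add: matrix_transpose_mul[symmetric])
  qed (simp_all only: sf(1) pol, simp add: matrix_transpose_mul[symmetric] sf(4))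
qed

section \<open>Twisting by spectral projections\<close>

lemma plane_wave_0 [simp]: "plane_wave \<kappa> 0 = 1"
  by (simp add: plane_wave_def)

lemma plane_wave_add: "plane_wave \<kappa> (\<theta> + \<eta>) = plane_wave \<kappa> \<theta> * plane_wave \<kappa> \<eta>"
  by (simp add: plane_wave_def inner_add_right algebra_simps exp_add)

lemma cnj_plane_wave: "cnj (plane_wave \<kappa> \<theta>) = plane_wave (- \<kappa>) \<theta>"
  by (simp add: plane_wave_def exp_cnj)

lemma plane_wave_uminus: "plane_wave \<kappa> (- \<theta>) = plane_wave (- \<kappa>) \<theta>"
  by (simp add: plane_wave_def)

text \<open>The twist multiplies the component with eigenvalue \<open>e(a)\<close> by a wave whose frequency depends on the
  imaginary part of the eigenvalue only. It commutes with \<open>E\<close>, and along the flow it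
  is a one-parameter group with imaginary eigenvalues (\<open>spectral_twist_flow_derivative\<close>).\<close>
definition spectral_twist ::
    "(real \<Rightarrow> real^'d) \<Rightarrow> 'i set \<Rightarrow> ('i \<Rightarrow> complex) \<Rightarrow> ('i \<Rightarrow> complex^'n^'n) \<Rightarrow> real^'d \<Rightarrow> complex^'n^'n" where
  "spectral_twist \<kappa> I e P \<theta> = (\<Sum>a\<in>I. mat (plane_wave (\<kappa> (Im (e a))) \<theta>) ** P a)"

lemma scaled_matrix_mult: "(mat a ** M) ** (mat b ** N) = mat (a * b) ** (M ** N)"
  for M N :: "complex^'n^'n"
  by (metis mat_commute mat_mult_mat matrix_mul_assoc)

lemma spectral_calculus_mult:
  assumes "spectral_family E I e P"
  shows "(\<Sum>a\<in>I. mat (f a) ** P a) ** (\<Sum>a\<in>I. mat (g a) ** P a) = (\<Sum>a\<in>I. mat (f a * g a) ** P a)"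
proof -
  have "(\<Sum>a\<in>I. mat (f a) ** P a) ** (\<Sum>a\<in>I. mat (g a) ** P a) =
      (\<Sum>a\<in>I. \<Sum>b\<in>I. (mat (f a) ** P a) ** (mat (g b) ** P b))"
    by (simp only: matmul.sum_left) (simp only: matmul.sum_right)
  also have "\<dots> = (\<Sum>a\<in>I. \<Sum>b\<in>I. if b = a then mat (f a * g a) ** P a else 0)"
    using assms
    by (intro sum.cong refl) (auto simp: scaled_matrix_mult spectral_family_def matmul.zero_right)
  also have "\<dots> = (\<Sum>a\<in>I. mat (f a * g a) ** P a)"
    using assms by (simp add: spectral_family_def)
  finally show ?thesis .
qed

lemma spectral_twist_0: "spectral_family E I e P \<Longrightarrow> spectral_twist \<kappa> I e P 0 = mat 1"
  by (simp add: spectral_twist_def spectral_family_def)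

lemma spectral_twist_add:
  assumes "spectral_family E I e P"
  shows "spectral_twist \<kappa> I e P (\<theta> + \<eta>) = spectral_twist \<kappa> I e P \<theta> ** spectral_twist \<kappa> I e P \<eta>"
  by (simp add: spectral_twist_def plane_wave_add spectral_calculus_mult[OF assms])

lemma spectral_twist_inverse: "spectral_family E I e P \<Longrightarrow> spectral_twist \<kappa> I e P \<theta> ** spectral_twist \<kappa> I e P (- \<theta>) = mat 1"
  using spectral_twist_add[of E I e P \<kappa> \<theta> "- \<theta>"] spectral_twist_0[of E I e P \<kappa>] by simp

lemma continuous_on_spectral_twist: "continuous_on S (spectral_twist \<kappa> I e P)"
proof -
  have "continuous_on S (\<lambda>\<theta>. spectral_twist \<kappa> I e P \<theta>)"
    unfolding spectral_twist_def
    by (intro continuous_on_matrixI) (simp add: plane_wave_def, intro continuous_intros)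
  then show ?thesis by simp
qed

lemma spectral_twist_flow_derivative:
  fixes \<kappa> :: "real \<Rightarrow> real^'d" and \<omega> :: "real^'d" and P :: "'i \<Rightarrow> complex^'n^'n"
  assumes "spectral_family E I e P"
  defines "D \<equiv> \<Sum>a\<in>I. mat (\<i> * of_real (\<kappa> (Im (e a)) \<bullet> \<omega>)) ** P a"
  shows "((\<lambda>t. spectral_twist \<kappa> I e P (t *\<^sub>R \<omega>)) has_vector_derivative D ** spectral_twist \<kappa> I e P (t *\<^sub>R \<omega>)) (at t)"
proof -
  let ?c = "\<lambda>a. plane_wave (\<kappa> (Im (e a)))" and ?d = "\<lambda>a. \<i> * of_real (\<kappa> (Im (e a)) \<bullet> \<omega>)"
  have eq: "D ** spectral_twist \<kappa> I e P (t *\<^sub>R \<omega>) = (\<Sum>a\<in>I. mat (?d a * ?c a (t *\<^sub>R \<omega>)) ** P a)"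
    unfolding D_def spectral_twist_def by (rule spectral_calculus_mult[OF assms(1)])
  have "((\<lambda>t. ?c a (t *\<^sub>R \<omega>)) has_vector_derivative ?d a * ?c a (t *\<^sub>R \<omega>)) (at t)" for a
  proof -
    have "((\<lambda>z. exp (?d a * z)) has_field_derivative ?d a * exp (?d a * of_real t)) (at (of_real t))"
      by (auto intro!: derivative_eq_intros)
    from has_vector_derivative_real_field[OF this] show ?thesis
      by (simp add: plane_wave_def mult_ac)
  qed
  note dc = this
  have "((\<lambda>t. mat (?c a (t *\<^sub>R \<omega>)) ** P a) has_vector_derivative mat (?d a * ?c a (t *\<^sub>R \<omega>)) ** P a) (at t)" for a
    by (intro has_vector_derivative_vecI) (auto intro!: has_vector_derivative_mult_left[OF dc])
  then show ?thesis
    unfolding eq unfolding spectral_twist_def by (intro has_vector_derivative_sum)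
qed

lemma matrix_triple_mult_nth:
  "(A ** M ** N) $ i $ j = (\<Sum>l\<in>UNIV. \<Sum>k\<in>UNIV. A $ i $ k * M $ k $ l * N $ l $ j)"
  for A M N :: "complex^'n^'n"
  by (simp add: matrix_matrix_mult_def sum_distrib_right)

text \<open>For each pair of eigenvalues the corresponding block of \<open>W\<close> is a quasi-polynomial along the
  flow, so each of its entries is zero or a character whose frequency \<open>2\<pi>k\<close> is given by the
  difference of the imaginary parts. The assumption on \<open>\<kappa>\<close> says that the two twists contribute
  the opposite frequency.\<close>
lemma twisted_intertwiner_constant:
  fixes \<omega> :: "real^'d" and E1 E2 :: "real \<Rightarrow> complex^'n^'n"
  assumes \<omega>: "rationally_independent \<omega>"
    and \<kappa>: "\<And>b k. k \<in> int_lattice \<Longrightarrow> \<kappa> (b + 2 * pi * (k \<bullet> \<omega>)) = \<kappa> b - (2 * pi) *\<^sub>R k"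
    and sf1: "spectral_family E1 I1 e1 P1" and sf2: "spectral_family E2 I2 e2 P2"
    and E1: "\<And>t. E1 t ** E1 (- t) = mat 1"
    and W: "continuous_on UNIV W" "torus_periodic 1 W"
    and intertw: "\<And>t \<theta>. W (\<theta> + t *\<^sub>R \<omega>) ** E1 t = E2 t ** W \<theta>"
  shows "spectral_twist \<kappa> I2 e2 P2 \<theta> ** W \<theta> ** spectral_twist \<kappa> I1 e1 P1 (- \<theta>) = W 0"
proof -
  have block: "mat (plane_wave (\<kappa> (Im (e2 a))) \<theta> * plane_wave (\<kappa> (Im (e1 b))) (- \<theta>)) ** (P2 a ** W \<theta> ** P1 b)
      = P2 a ** W 0 ** P1 b" if ab: "a \<in> I2" "b \<in> I1" for a b
  proof -
    define U where "U \<theta> = P2 a ** W \<theta> ** P1 b" for \<theta>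
    have flow: "U (\<theta> + t *\<^sub>R \<omega>) = (E2 t ** P2 a) ** W \<theta> ** (E1 (- t) ** P1 b)" for \<theta> t
    proof -
      have "W (\<theta> + t *\<^sub>R \<omega>) = E2 t ** W \<theta> ** E1 (- t)"
        by (metis E1 intertw matrix_mul_assoc matrix_mul_rid)
      moreover have "E2 t ** P2 a = P2 a ** E2 t" using sf2 ab by (simp add: spectral_family_def)
      ultimately show ?thesis by (simp add: U_def matrix_mul_assoc)
    qed
    have "plane_wave (\<kappa> (Im (e2 a))) \<theta> * plane_wave (\<kappa> (Im (e1 b))) (- \<theta>) * U \<theta> $ i $ j = U 0 $ i $ j" for i j
    proof (cases "\<exists>\<theta>. U \<theta> $ i $ j \<noteq> 0")
      case True
      then obtain \<theta>\<^sub>0 where nz: "U \<theta>\<^sub>0 $ i $ j \<noteq> 0" by blast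
      have c: "continuous_on UNIV (\<lambda>\<theta>. U \<theta> $ i $ j)"
        unfolding U_def by (intro continuous_intros matmul.continuous_on W)
      have p: "torus_periodic 1 (\<lambda>\<theta>. U \<theta> $ i $ j)"
        using W(2) by (simp add: torus_periodic_def U_def)
      have "polynomial_in_time (\<lambda>t. exp (- (of_real t * (e2 a - e1 b))) * U (\<theta> + t *\<^sub>R \<omega>) $ i $ j)" for \<theta>
      proof -
        have "exp (- (of_real t * (e2 a - e1 b))) * U (\<theta> + t *\<^sub>R \<omega>) $ i $ j =
          (\<Sum>l\<in>UNIV. \<Sum>k\<in>UNIV. (exp (- (of_real t * e2 a)) * (E2 t ** P2 a) $ i $ k) * W \<theta> $ k $ l *
             (exp (- (of_real (- t) * e1 b)) * (E1 (- t) ** P1 b) $ l $ j))" for t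
        proof -
          have "exp (- (of_real t * (e2 a - e1 b))) = exp (- (of_real t * e2 a)) * exp (- (of_real (- t) * e1 b))"
            by (simp add: exp_add[symmetric] algebra_simps)
          moreover have "U (\<theta> + t *\<^sub>R \<omega>) $ i $ j =
            (\<Sum>l\<in>UNIV. \<Sum>k\<in>UNIV. (E2 t ** P2 a) $ i $ k * W \<theta> $ k $ l * (E1 (- t) ** P1 b) $ l $ j)"
            unfolding flow by (rule matrix_triple_mult_nth)
          ultimately show ?thesis by (simp add: sum_distrib_left mult_ac)
        qed
        moreover have p2: "polynomial_in_time (\<lambda>t. exp (- (of_real t * e2 a)) * (E2 t ** P2 a) $ i $ k)" for k
          by (rule spectral_familyD(5)[OF sf2 ab(1)])
        moreover have p1: "polynomial_in_time (\<lambda>t. exp (- (of_real (- t) * e1 b)) * (E1 (- t) ** P1 b) $ l $ j)" for l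
          by (rule polynomial_in_time_uminus[OF spectral_familyD(5)[OF sf1 ab(2)]])
        ultimately show ?thesis
          by (simp only:) (intro polynomial_in_time_sum polynomial_in_time_mult[OF polynomial_in_time_mult]
              polynomial_in_time_const p1 p2)
      qed
      from flow_quasi_polynomial_is_char[OF \<omega> c p this nz] obtain k where k: "k \<in> int_lattice"
        "Im (e2 a - e1 b) = 2 * pi * (k \<bullet> \<omega>)"
        "\<And>\<theta>. U \<theta> $ i $ j = plane_wave ((2 * pi) *\<^sub>R k) \<theta> * U 0 $ i $ j"
        by blast
      have "Im (e2 a) = Im (e1 b) + 2 * pi * (k \<bullet> \<omega>)" using k(2) by simp
      then have eq: "\<kappa> (Im (e2 a)) = \<kappa> (Im (e1 b)) - (2 * pi) *\<^sub>R k" using \<kappa>[OF k(1)] by simp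
      have "plane_wave (\<kappa> (Im (e2 a))) \<theta> * plane_wave (\<kappa> (Im (e1 b))) (- \<theta>) * plane_wave ((2 * pi) *\<^sub>R k) \<theta> = 1"
        unfolding plane_wave_def exp_add[symmetric] eq by (simp add: algebra_simps)
      then show ?thesis by (subst k(3)) (simp add: mult.assoc[symmetric])
    next
      case False
      then show ?thesis by simp
    qed
    then show ?thesis by (simp add: vec_eq_iff U_def)
  qed
  let ?c2 = "\<lambda>a. plane_wave (\<kappa> (Im (e2 a))) \<theta>" and ?c1 = "\<lambda>b. plane_wave (\<kappa> (Im (e1 b))) (- \<theta>)"
  have "spectral_twist \<kappa> I2 e2 P2 \<theta> ** W \<theta> ** spectral_twist \<kappa> I1 e1 P1 (- \<theta>) =
      (\<Sum>a\<in>I2. \<Sum>b\<in>I1. mat (?c2 a) ** P2 a ** W \<theta> ** (mat (?c1 b) ** P1 b))"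
    by (simp only: spectral_twist_def matmul.sum_left) (simp only: matmul.sum_right)
  also have "\<dots> = (\<Sum>a\<in>I2. \<Sum>b\<in>I1. P2 a ** W 0 ** P1 b)"
  proof (intro sum.cong refl)
    fix a b assume ab: "a \<in> I2" "b \<in> I1"
    have "mat (?c2 a) ** P2 a ** W \<theta> ** (mat (?c1 b) ** P1 b) = mat (?c2 a * ?c1 b) ** (P2 a ** W \<theta> ** P1 b)"
      using scaled_matrix_mult[of "?c2 a" "P2 a ** W \<theta>"] by (simp add: matrix_mul_assoc)
    then show "mat (?c2 a) ** P2 a ** W \<theta> ** (mat (?c1 b) ** P1 b) = P2 a ** W 0 ** P1 b"
      using block[OF ab] by simp
  qed
  also have "\<dots> = (\<Sum>a\<in>I2. P2 a) ** W 0 ** (\<Sum>b\<in>I1. P1 b)"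
    by (simp only: matmul.sum_left) (simp only: matmul.sum_right)
  also have "\<dots> = W 0" using sf1 sf2 by (simp add: spectral_family_def)
  finally show ?thesis .
qed

section \<open>Cancelling resonances by frequency shifts\<close>

text \<open>This makes \<open>b + \<langle>\<kappa>(b),\<omega>\<rangle>\<close> depend only on the class of \<open>b\<close> modulo \<open>2\<pi>\<langle>\<int>\<^sup>d,\<omega>\<rangle>\<close>: shifted
  eigenvalues are equal in imaginary part as soon as they are resonant.\<close>
definition resonance_equivariant :: "real^'d \<Rightarrow> (real \<Rightarrow> real^'d) \<Rightarrow> bool" where
  "resonance_equivariant \<omega> \<kappa> \<longleftrightarrow>
    (\<forall>b. \<forall>k\<in>int_lattice. \<kappa> (b + 2 * pi * (k \<bullet> \<omega>)) = \<kappa> b - (2 * pi) *\<^sub>R k)"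

lemma int_lattice_simps:
  "k \<in> int_lattice \<Longrightarrow> l \<in> int_lattice \<Longrightarrow> k + l \<in> int_lattice"
  "k \<in> int_lattice \<Longrightarrow> l \<in> int_lattice \<Longrightarrow> k - l \<in> int_lattice"
  "k \<in> int_lattice \<Longrightarrow> - k \<in> int_lattice"
  "k \<in> int_lattice \<Longrightarrow> real n *\<^sub>R k \<in> int_lattice"
  by (auto simp: int_lattice_def)

lemma inner_int_lattice: "k \<in> int_lattice \<Longrightarrow> l \<in> int_lattice \<Longrightarrow> k \<bullet> l \<in> \<int>"
  by (auto simp: int_lattice_def inner_vec_def intro!: Ints_sum Ints_mult)

lemma plane_wave_eq_1:
  assumes "r \<in> \<int>" "\<kappa> \<bullet> \<theta> = 2 * pi * r"
  shows "plane_wave \<kappa> \<theta> = 1"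
proof -
  obtain n where "r = of_int n" using assms(1) by (elim Ints_cases)
  then show ?thesis unfolding plane_wave_def exp_eq_1 by (simp add: assms(2))
qed

text \<open>Move every \<open>b\<close> to a representative of its class. Rational independence makes the lattice
  vector that does this unique, whence the equivariance.\<close>
lemma exists_integral_shift:
  assumes \<omega>: "rationally_independent \<omega>"
  shows "\<exists>\<kappa>. resonance_equivariant \<omega> \<kappa> \<and> (\<forall>b. \<exists>m\<in>int_lattice. \<kappa> b = (2 * pi) *\<^sub>R m)"
proof -
  \<comment> \<open>The choice depends on \<open>b\<close> only through its class, which is what \<open>rep_cong\<close> expresses.\<close>
  define rep where "rep b = (SOME x. \<exists>k\<in>int_lattice. x = b + 2 * pi * (k \<bullet> \<omega>))" for b
  have ex: "\<exists>k\<in>int_lattice. rep b = b + 2 * pi * (k \<bullet> \<omega>)" for b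
  proof -
    have "\<exists>x. \<exists>k\<in>int_lattice. x = b + 2 * pi * (k \<bullet> \<omega>)"
      by (intro exI[of _ b] bexI[of _ 0]) (auto simp: int_lattice_def)
    then show ?thesis unfolding rep_def by (rule someI_ex)
  qed
  then obtain m where m: "\<And>b. m b \<in> int_lattice" "\<And>b. rep b = b + 2 * pi * (m b \<bullet> \<omega>)"
    by metis
  have rep_cong: "rep (b + 2 * pi * (k \<bullet> \<omega>)) = rep b" if k: "k \<in> int_lattice" for b k
  proof -
    have "(\<exists>l\<in>int_lattice. x = b + 2 * pi * (k \<bullet> \<omega>) + 2 * pi * (l \<bullet> \<omega>)) \<longleftrightarrow>
        (\<exists>l\<in>int_lattice. x = b + 2 * pi * (l \<bullet> \<omega>))" for x
    proof (intro iffI; elim bexE)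
      fix l assume "l \<in> int_lattice" "x = b + 2 * pi * (k \<bullet> \<omega>) + 2 * pi * (l \<bullet> \<omega>)"
      then show "\<exists>l\<in>int_lattice. x = b + 2 * pi * (l \<bullet> \<omega>)"
        using k by (intro bexI[of _ "k + l"]) (auto simp: inner_add_left algebra_simps int_lattice_simps)
    next
      fix l assume "l \<in> int_lattice" "x = b + 2 * pi * (l \<bullet> \<omega>)"
      then show "\<exists>l\<in>int_lattice. x = b + 2 * pi * (k \<bullet> \<omega>) + 2 * pi * (l \<bullet> \<omega>)"
        using k by (intro bexI[of _ "l - k"]) (auto simp: inner_diff_left algebra_simps int_lattice_simps)
    qed
    then show ?thesis by (simp add: rep_def)
  qed
  have "m (b + 2 * pi * (k \<bullet> \<omega>)) = m b - k" if k: "k \<in> int_lattice" for b k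
  proof -
    let ?l = "k + m (b + 2 * pi * (k \<bullet> \<omega>)) - m b"
    have "2 * pi * (?l \<bullet> \<omega>) = 0"
      using rep_cong[OF k, of b] m(2)[of b] m(2)[of "b + 2 * pi * (k \<bullet> \<omega>)"]
      by (simp add: inner_add_left inner_diff_left algebra_simps)
    moreover have "?l \<in> int_lattice" by (intro int_lattice_simps k m(1))
    ultimately have "?l = 0" using \<omega> by (auto simp: rationally_independent_def)
    then show ?thesis by (simp add: algebra_simps)
  qed
  then have "resonance_equivariant \<omega> (\<lambda>b. (2 * pi) *\<^sub>R m b)"
    by (simp add: resonance_equivariant_def scaleR_diff_right)
  then show ?thesis using m(1) by blast
qed

text \<open>The odd part of an equivariant shift is equivariant, because \<open>b\<close> and \<open>-b\<close> are displaced by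
  opposite lattice vectors. Halving costs a factor \<open>2\<close> in the lattice: a class closed under
  \<open>b \<mapsto> -b\<close> consists of multiples \<open>\<pi>\<langle>k,\<omega>\<rangle>\<close> and has to be moved to \<open>0\<close>.\<close>
lemma exists_odd_half_integral_shift:
  assumes \<omega>: "rationally_independent \<omega>"
  shows "\<exists>\<kappa>. resonance_equivariant \<omega> \<kappa> \<and> (\<forall>b. \<kappa> (- b) = - \<kappa> b) \<and> (\<forall>b. \<exists>m\<in>int_lattice. \<kappa> b = pi *\<^sub>R m)"
proof -
  obtain \<kappa> where \<kappa>: "resonance_equivariant \<omega> \<kappa>" "\<And>b. \<exists>m\<in>int_lattice. \<kappa> b = (2 * pi) *\<^sub>R m"
    using exists_integral_shift[OF \<omega>] by blast
  define \<rho> where "\<rho> b = (1 / 2) *\<^sub>R (\<kappa> b - \<kappa> (- b))" for b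
  have "resonance_equivariant \<omega> \<rho>"
    unfolding resonance_equivariant_def
  proof (intro allI ballI)
    fix b and k :: "real^'a" assume k: "k \<in> int_lattice"
    have 1: "\<kappa> (b + 2 * pi * (k \<bullet> \<omega>)) = \<kappa> b - (2 * pi) *\<^sub>R k"
      using \<kappa>(1) k by (simp add: resonance_equivariant_def)
    have "\<kappa> (- b + 2 * pi * (- k \<bullet> \<omega>)) = \<kappa> (- b) - (2 * pi) *\<^sub>R (- k)"
      using \<kappa>(1) int_lattice_simps(3)[OF k] unfolding resonance_equivariant_def by blast
    then have 2: "\<kappa> (- (b + 2 * pi * (k \<bullet> \<omega>))) = \<kappa> (- b) + (2 * pi) *\<^sub>R k" by simp
    show "\<rho> (b + 2 * pi * (k \<bullet> \<omega>)) = \<rho> b - (2 * pi) *\<^sub>R k"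
      unfolding \<rho>_def 1 2 by (simp add: vec_eq_iff field_simps)
  qed
  moreover have "\<rho> (- b) = - \<rho> b" for b by (simp add: \<rho>_def vec_eq_iff field_simps)
  moreover have "\<exists>m\<in>int_lattice. \<rho> b = pi *\<^sub>R m" for b
  proof -
    obtain m n where "m \<in> int_lattice" "\<kappa> b = (2 * pi) *\<^sub>R m" "n \<in> int_lattice" "\<kappa> (- b) = (2 * pi) *\<^sub>R n"
      using \<kappa>(2) by metis
    then show ?thesis
      by (intro bexI[of _ "m - n"]) (simp_all add: \<rho>_def vec_eq_iff field_simps int_lattice_simps)
  qed
  ultimately show ?thesis by blast
qed

section \<open>The normalised conjugacy\<close>

text \<open>The twist commutes with \<open>e\<^sup>t\<^sup>B\<close>, so it changes the constant cocycle into
  \<open>e\<^sup>t\<^sup>B S(t\<omega>)\<close>, again a one-parameter group. The factor \<open>Z(0)\<^sup>-\<^sup>1\<close> makes \<open>Z'(0) = 1\<close>, so the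
  new group equals \<open>Z'(t\<omega>) X\<^sup>t(0)\<close>; therefore it lies in any group that contains \<open>Z'\<close> and \<open>X\<close>.\<close>
lemma twisted_conjugacy:
  fixes X :: "real \<Rightarrow> real^'d \<Rightarrow> complex^'n^'n" and Z :: "real^'d \<Rightarrow> complex^'n^'n"
  assumes Z: "continuous_on UNIV Z" "torus_periodic 1 Z" "\<And>\<theta>. invertible (Z \<theta>)"
    and X: "\<And>t \<theta>. X t \<theta> = matrix_inv (Z (\<theta> + t *\<^sub>R \<omega>)) ** mexp (t *\<^sub>R B) ** Z \<theta>"
    and sf: "spectral_family (\<lambda>t. mexp (t *\<^sub>R B)) I e P" and BP: "\<forall>a\<in>I. B ** P a = P a ** B"
    and triv: "\<forall>b. \<forall>k\<in>int_lattice. plane_wave (\<kappa> b) (real N *\<^sub>R k) = 1"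
  defines "Z' \<equiv> \<lambda>\<theta>. matrix_inv (Z 0) ** spectral_twist \<kappa> I e P \<theta> ** Z \<theta>"
  shows "continuous_on UNIV Z'" "torus_periodic N Z'" "\<And>\<theta>. invertible (Z' \<theta>)" "Z' 0 = mat 1"
    "\<exists>B'. \<forall>t. mexp (t *\<^sub>R B') = Z' (t *\<^sub>R \<omega>) ** X t 0 \<and>
      (\<forall>\<theta>. X t \<theta> = matrix_inv (Z' (\<theta> + t *\<^sub>R \<omega>)) ** mexp (t *\<^sub>R B') ** Z' \<theta>)"
proof -
  let ?S = "spectral_twist \<kappa> I e P" and ?Zi = "matrix_inv (Z 0)"
  note Zi = matrix_inv[OF Z(3)]
  show "continuous_on UNIV Z'"
    unfolding Z'_def by (intro matmul.continuous_on continuous_on_const continuous_on_spectral_twist Z)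
  have "?S (\<theta> + real N *\<^sub>R k) = ?S \<theta>" if "k \<in> int_lattice" for \<theta> k
    using triv that by (simp add: spectral_twist_def plane_wave_add)
  moreover have "Z (\<theta> + real N *\<^sub>R k) = Z \<theta>" if "k \<in> int_lattice" for \<theta> k
    using Z(2) int_lattice_simps(4)[OF that] by (simp add: torus_periodic_def)
  ultimately show "torus_periodic N Z'" by (simp add: torus_periodic_def Z'_def)
  have Sinv: "invertible (?S \<theta>)" for \<theta> by (rule matrix_inv_eqI(1)[OF spectral_twist_inverse[OF sf]])
  show Z'inv: "invertible (Z' \<theta>)" for \<theta>
    unfolding Z'_def by (intro invertible_mult invertible_matrix_inv Sinv Z)
  show "Z' 0 = mat 1" by (simp add: Z'_def spectral_twist_0[OF sf] Zi)
  define D where "D = (\<Sum>a\<in>I. mat (\<i> * of_real (\<kappa> (Im (e a)) \<bullet> \<omega>)) ** P a)"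
  define Y where "Y t = ?Zi ** (mexp (t *\<^sub>R B) ** ?S (t *\<^sub>R \<omega>)) ** Z 0" for t
  define B' where "B' = ?Zi ** (B + D) ** Z 0"
  have ED: "mexp (t *\<^sub>R B) ** D = D ** mexp (t *\<^sub>R B)" for t
    using spectral_familyD(4)[OF sf] unfolding D_def matmul.sum_left matmul.sum_right
    by (intro sum.cong refl) (metis mat_commute matrix_mul_assoc)
  have Y': "(Y has_vector_derivative B' ** Y t) (at t)" for t
  proof -
    have "((\<lambda>t. mexp (t *\<^sub>R B) ** ?S (t *\<^sub>R \<omega>)) has_vector_derivative
        mexp (t *\<^sub>R B) ** (D ** ?S (t *\<^sub>R \<omega>)) + (B ** mexp (t *\<^sub>R B)) ** ?S (t *\<^sub>R \<omega>)) (at t)"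
      using matmul.has_vector_derivative[OF has_vector_derivative_mexp spectral_twist_flow_derivative[OF sf]]
      unfolding D_def .
    also have "mexp (t *\<^sub>R B) ** (D ** ?S (t *\<^sub>R \<omega>)) + (B ** mexp (t *\<^sub>R B)) ** ?S (t *\<^sub>R \<omega>) =
        (B + D) ** (mexp (t *\<^sub>R B) ** ?S (t *\<^sub>R \<omega>))"
      by (simp add: matmul.add_left matrix_mul_assoc ED)
    finally have "((\<lambda>t. ?Zi ** (mexp (t *\<^sub>R B) ** ?S (t *\<^sub>R \<omega>)) ** Z 0) has_vector_derivative
        ?Zi ** ((B + D) ** (mexp (t *\<^sub>R B) ** ?S (t *\<^sub>R \<omega>))) ** Z 0) (at t)"
      by (intro bounded_linear.has_vector_derivative[OF matmul.bounded_linear_left]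
          bounded_linear.has_vector_derivative[OF matmul.bounded_linear_right])
    moreover have "?Zi ** ((B + D) ** M) ** Z 0 = B' ** (?Zi ** M ** Z 0)" for M
      unfolding B'_def by (metis Zi(1) matrix_mul_assoc matrix_mul_rid)
    ultimately show ?thesis by (simp add: Y_def[abs_def])
  qed
  have "Y 0 = mat 1" by (simp add: Y_def spectral_twist_0[OF sf] Zi)
  then have EY: "mexp (t *\<^sub>R B') = Y t" for t using mexp_solves_uniquely[OF Y', of t] by simp
  have com: "mexp (t *\<^sub>R B) ** ?S \<theta> = ?S \<theta> ** mexp (t *\<^sub>R B)" for t \<theta>
    using spectral_familyD(4)[OF sf] unfolding spectral_twist_def matmul.sum_left matmul.sum_right
    by (intro sum.cong refl) (metis mat_commute matrix_mul_assoc)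
  have key: "Y t ** Z' \<theta> = Z' (\<theta> + t *\<^sub>R \<omega>) ** X t \<theta>" for t \<theta>
  proof -
    have "Y t ** Z' \<theta> = ?Zi ** (mexp (t *\<^sub>R B) ** ?S (t *\<^sub>R \<omega>)) ** (Z 0 ** ?Zi) ** (?S \<theta> ** Z \<theta>)"
      by (simp add: Y_def Z'_def matrix_mul_assoc)
    also have "\<dots> = ?Zi ** mexp (t *\<^sub>R B) ** (?S (t *\<^sub>R \<omega>) ** ?S \<theta>) ** Z \<theta>"
      by (simp add: Zi matrix_mul_assoc)
    also have "?S (t *\<^sub>R \<omega>) ** ?S \<theta> = ?S (\<theta> + t *\<^sub>R \<omega>)"
      by (simp add: spectral_twist_add[OF sf, symmetric] add.commute)
    also have "?Zi ** mexp (t *\<^sub>R B) ** ?S (\<theta> + t *\<^sub>R \<omega>) ** Z \<theta> =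
        ?Zi ** ?S (\<theta> + t *\<^sub>R \<omega>) ** (Z (\<theta> + t *\<^sub>R \<omega>) ** matrix_inv (Z (\<theta> + t *\<^sub>R \<omega>))) ** mexp (t *\<^sub>R B) ** Z \<theta>"
      unfolding Zi matrix_mul_rid by (simp add: matrix_mul_assoc[symmetric]) (simp add: matrix_mul_assoc com)
    also have "\<dots> = Z' (\<theta> + t *\<^sub>R \<omega>) ** X t \<theta>"
      by (simp add: Z'_def X matrix_mul_assoc)
    finally show ?thesis .
  qed
  have "mexp (t *\<^sub>R B') = Z' (t *\<^sub>R \<omega>) ** X t 0" for t
    using key[of t 0] by (simp add: EY \<open>Z' 0 = mat 1\<close>)
  moreover have "X t \<theta> = matrix_inv (Z' (\<theta> + t *\<^sub>R \<omega>)) ** mexp (t *\<^sub>R B') ** Z' \<theta>" for t \<theta>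
    unfolding EY matrix_mul_assoc[symmetric] key by (simp add: matrix_mul_assoc matrix_inv[OF Z'inv])
  ultimately show "\<exists>B'. \<forall>t. mexp (t *\<^sub>R B') = Z' (t *\<^sub>R \<omega>) ** X t 0 \<and>
      (\<forall>\<theta>. X t \<theta> = matrix_inv (Z' (\<theta> + t *\<^sub>R \<omega>)) ** mexp (t *\<^sub>R B') ** Z' \<theta>)"
    by blast
qed

text \<open>The function \<open>W = \<sigma>(Z) C Z\<^sup>-\<^sup>1\<close> becomes constant after twisting, so twisting carries it
  to \<open>W(0)\<close>; the normalisation of \<open>Z'\<close> at \<open>0\<close> turns this into the relation that \<open>X\<close> satisfies.\<close>
lemma twisted_conjugacy_intertwines:
  fixes X :: "real \<Rightarrow> real^'d \<Rightarrow> complex^'n^'n" and Z :: "real^'d \<Rightarrow> complex^'n^'n"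
    and \<sigma> :: "complex^'n^'n \<Rightarrow> complex^'n^'n" and C :: "complex^'n^'n"
  assumes \<omega>: "rationally_independent \<omega>" and \<kappa>: "resonance_equivariant \<omega> \<kappa>"
    and Z: "continuous_on UNIV Z" "torus_periodic 1 Z" "\<And>\<theta>. invertible (Z \<theta>)"
    and X: "\<And>t \<theta>. X t \<theta> = matrix_inv (Z (\<theta> + t *\<^sub>R \<omega>)) ** mexp (t *\<^sub>R B) ** Z \<theta>"
    and sf: "spectral_family (\<lambda>t. mexp (t *\<^sub>R B)) I e P"
    and \<sigma>: "\<sigma> (mat 1) = mat 1" "\<And>M N. invertible M \<Longrightarrow> invertible N \<Longrightarrow> \<sigma> (M ** N) = \<sigma> M ** \<sigma> N"
      "continuous_on UNIV (\<lambda>\<theta>. \<sigma> (Z \<theta>))"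
    and sf2: "spectral_family (\<lambda>t. \<sigma> (mexp (t *\<^sub>R B))) I e2 P2"
    and twist2: "\<And>\<theta>. \<sigma> (spectral_twist \<kappa> I e P \<theta>) = spectral_twist \<kappa> I e2 P2 \<theta>"
    and C: "\<And>t \<theta>. C ** X t \<theta> = \<sigma> (X t \<theta>) ** C"
  defines "Z' \<equiv> \<lambda>\<theta>. matrix_inv (Z 0) ** spectral_twist \<kappa> I e P \<theta> ** Z \<theta>"
  shows "C ** Z' \<theta> = \<sigma> (Z' \<theta>) ** C"
proof -
  let ?S = "spectral_twist \<kappa> I e P" and ?S2 = "spectral_twist \<kappa> I e2 P2"
  note Zi = matrix_inv[OF Z(3)]
  define W where "W \<theta> = \<sigma> (Z \<theta>) ** C ** matrix_inv (Z \<theta>)" for \<theta>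
  have Einv: "invertible (mexp (t *\<^sub>R B))" for t
    using mexp_minus[of "- t" B] by (auto intro: matrix_inv_eqI(1))
  have Sinv: "invertible (?S \<theta>)" for \<theta> by (rule matrix_inv_eqI(1)[OF spectral_twist_inverse[OF sf]])
  have Xinv: "invertible (X t \<theta>)" for t \<theta>
    unfolding X by (intro invertible_mult invertible_matrix_inv Z Einv)
  have ZX: "Z (\<theta> + t *\<^sub>R \<omega>) ** X t \<theta> = mexp (t *\<^sub>R B) ** Z \<theta>" for t \<theta>
    unfolding X by (simp add: matrix_mul_assoc Zi)
  \<comment> \<open>The relation between \<open>X\<close> and \<open>\<sigma>(X)\<close> becomes one between \<open>e\<^sup>t\<^sup>B\<close> and \<open>\<sigma>(e\<^sup>t\<^sup>B)\<close>.\<close>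
  have inter: "W (\<theta> + t *\<^sub>R \<omega>) ** mexp (t *\<^sub>R B) = \<sigma> (mexp (t *\<^sub>R B)) ** W \<theta>" for t \<theta>
  proof -
    let ?Z = "Z (\<theta> + t *\<^sub>R \<omega>)"
    have "mexp (t *\<^sub>R B) = ?Z ** X t \<theta> ** matrix_inv (Z \<theta>)"
      unfolding ZX by (simp add: matrix_mul_assoc[symmetric] Zi)
    then have "W (\<theta> + t *\<^sub>R \<omega>) ** mexp (t *\<^sub>R B) = \<sigma> ?Z ** C ** (matrix_inv ?Z ** ?Z) ** X t \<theta> ** matrix_inv (Z \<theta>)"
      by (simp add: W_def matrix_mul_assoc)
    also have "\<dots> = \<sigma> ?Z ** (C ** X t \<theta>) ** matrix_inv (Z \<theta>)"
      by (simp add: Zi matrix_mul_assoc)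
    also have "\<dots> = \<sigma> (?Z ** X t \<theta>) ** C ** matrix_inv (Z \<theta>)"
      by (simp add: C \<sigma>(2) Z(3) Xinv matrix_mul_assoc)
    also have "\<dots> = \<sigma> (mexp (t *\<^sub>R B)) ** W \<theta>"
      by (simp add: ZX \<sigma>(2) Z(3) Einv W_def matrix_mul_assoc)
    finally show ?thesis .
  qed
  have Wc: "continuous_on UNIV W"
    unfolding W_def
    by (intro matmul.continuous_on continuous_on_const \<sigma>(3) continuous_on_matrix_inv Z)
  have Wp: "torus_periodic 1 W" using Z(2) by (simp add: torus_periodic_def W_def)
  have const: "?S2 \<theta> ** W \<theta> ** ?S (- \<theta>) = W 0"
  proof (rule twisted_intertwiner_constant[where W = W and \<theta> = \<theta>])
    show "\<kappa> (b + 2 * pi * (k \<bullet> \<omega>)) = \<kappa> b - (2 * pi) *\<^sub>R k" if "k \<in> int_lattice" for b k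
      using \<kappa> that by (simp add: resonance_equivariant_def)
    show "mexp (t *\<^sub>R B) ** mexp (- t *\<^sub>R B) = mat 1" for t using mexp_minus[of "- t" B] by simp
  qed (fact \<omega> sf sf2 Wc Wp inter)+
  have SS: "?S (- \<theta>) ** ?S \<theta> = mat 1" using spectral_twist_inverse[OF sf, of \<kappa> "- \<theta>"] by simp
  have "W 0 ** ?S \<theta> ** Z \<theta> = ?S2 \<theta> ** W \<theta> ** (?S (- \<theta>) ** ?S \<theta>) ** Z \<theta>"
    unfolding const[symmetric] by (simp add: matrix_mul_assoc)
  also have "\<dots> = ?S2 \<theta> ** \<sigma> (Z \<theta>) ** C ** (matrix_inv (Z \<theta>) ** Z \<theta>)"
    unfolding SS W_def by (simp add: matrix_mul_assoc)
  also have "\<dots> = \<sigma> (?S \<theta> ** Z \<theta>) ** C"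
    by (simp add: Zi \<sigma>(2) Sinv Z(3) twist2)
  finally have eq: "W 0 ** ?S \<theta> ** Z \<theta> = \<sigma> (?S \<theta> ** Z \<theta>) ** C" .
  have "\<sigma> (matrix_inv (Z 0)) ** \<sigma> (Z 0) = mat 1"
    by (simp add: \<sigma>(1) \<sigma>(2)[symmetric] invertible_matrix_inv Z(3) Zi)
  then have "C ** Z' \<theta> = \<sigma> (matrix_inv (Z 0)) ** (W 0 ** ?S \<theta> ** Z \<theta>)"
    by (simp add: Z'_def W_def matrix_mul_assoc)
  also have "\<dots> = \<sigma> (Z' \<theta>) ** C"
    unfolding eq Z'_def by (simp add: \<sigma>(2) invertible_matrix_inv invertible_mult Sinv Z(3) matrix_mul_assoc)
  finally show ?thesis .
qed

text \<open>The twist built from the conjugated spectral data is the conjugated twist, provided that the shift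
  changes sign with the imaginary part.\<close>
lemma mat_cnj_spectral_twist:
  assumes odd: "\<forall>b. \<kappa> (- b) = - \<kappa> b"
  shows "mat_cnj (spectral_twist \<kappa> I e P \<theta>) = spectral_twist \<kappa> I (\<lambda>a. cnj (e a)) (\<lambda>a. mat_cnj (P a)) \<theta>"
  by (simp add: spectral_twist_def mat_cnj_sum mat_cnj_mult cnj_plane_wave odd)

lemma transpose_inv_spectral_twist:
  assumes sf: "spectral_family E I e P" and odd: "\<forall>b. \<kappa> (- b) = - \<kappa> b"
  shows "transpose (matrix_inv (spectral_twist \<kappa> I e P \<theta>)) =
    spectral_twist \<kappa> I (\<lambda>a. - e a) (\<lambda>a. transpose (P a)) \<theta>"
  unfolding matrix_inv_eqI(2)[OF spectral_twist_inverse[OF sf]]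
  by (simp add: spectral_twist_def transpose_sum matrix_transpose_mul plane_wave_uminus odd mat_commute)

text \<open>The map \<open>a \<mapsto> -cnj a\<close> on eigenvalues fixes imaginary parts, so both twists use the same
  frequencies.\<close>
lemma conj_transpose_inv_spectral_twist:
  assumes sf: "spectral_family E I e P"
  shows "conj_transpose (matrix_inv (spectral_twist \<kappa> I e P \<theta>)) =
    spectral_twist \<kappa> I (\<lambda>a. - cnj (e a)) (\<lambda>a. conj_transpose (P a)) \<theta>"
  unfolding matrix_inv_eqI(2)[OF spectral_twist_inverse[OF sf]] conj_transpose_eq
  by (simp add: spectral_twist_def mat_cnj_sum mat_cnj_mult transpose_sum matrix_transpose_mul
      plane_wave_uminus cnj_plane_wave mat_commute)

text \<open>One conjugacy that inherits all the relations at once, so that groups defined by several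
  relations, such as \<open>Sp(n,\<real>)\<close>, need no further adjustment.\<close>
lemma reducible_normal_form:
  fixes X :: "real \<Rightarrow> real^'d \<Rightarrow> complex^'n^'n"
  assumes \<omega>: "rationally_independent \<omega>" and red: "reducible GL_C \<omega> X"
    and \<kappa>: "resonance_equivariant \<omega> \<kappa>"
    and triv: "\<forall>b. \<forall>k\<in>int_lattice. plane_wave (\<kappa> b) (real N *\<^sub>R k) = 1"
  obtains Z B where "continuous_on UNIV Z" "torus_periodic N Z" "\<And>\<theta>. invertible (Z \<theta>)" "Z 0 = mat 1"
    "\<And>t. mexp (t *\<^sub>R B) = Z (t *\<^sub>R \<omega>) ** X t 0"
    "\<And>t \<theta>. X t \<theta> = matrix_inv (Z (\<theta> + t *\<^sub>R \<omega>)) ** mexp (t *\<^sub>R B) ** Z \<theta>"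
    "(\<forall>b. \<kappa> (- b) = - \<kappa> b) \<Longrightarrow> (\<forall>t \<theta>. real_entries (X t \<theta>)) \<Longrightarrow> (\<forall>\<theta>. real_entries (Z \<theta>))"
    "\<And>C. (\<forall>b. \<kappa> (- b) = - \<kappa> b) \<Longrightarrow> (\<forall>t \<theta>. transpose (X t \<theta>) ** C ** X t \<theta> = C) \<Longrightarrow>
      (\<forall>\<theta>. transpose (Z \<theta>) ** C ** Z \<theta> = C)"
    "(\<forall>t \<theta>. conj_transpose (X t \<theta>) ** X t \<theta> = mat 1) \<Longrightarrow> (\<forall>\<theta>. conj_transpose (Z \<theta>) ** Z \<theta> = mat 1)"
proof -
  obtain Z :: "real^'d \<Rightarrow> complex^'n^'n" and B where Zc: "continuous_on UNIV Z" "torus_periodic 1 Z" "range Z \<subseteq> GL_C"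
    and X: "\<And>t \<theta>. X t \<theta> = matrix_inv (Z (\<theta> + t *\<^sub>R \<omega>)) ** mexp (t *\<^sub>R B) ** Z \<theta>"
    using red unfolding reducible_mod_def by metis
  then have "invertible (Z \<theta>)" for \<theta> by (auto simp: GL_C_def)
  note Z = Zc(1,2) this
  obtain I P where sf: "spectral_family (\<lambda>t. mexp (t *\<^sub>R B)) I id P" and BP: "\<forall>a\<in>I. B ** P a = P a ** B"
    by (rule exists_spectral_family)
  define Z' where "Z' \<theta> = matrix_inv (Z 0) ** spectral_twist \<kappa> I id P \<theta> ** Z \<theta>" for \<theta>
  note conj = twisted_conjugacy[OF Z X sf BP triv, folded Z'_def]
  obtain B' where B': "\<And>t. mexp (t *\<^sub>R B') = Z' (t *\<^sub>R \<omega>) ** X t 0"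
    "\<And>t \<theta>. X t \<theta> = matrix_inv (Z' (\<theta> + t *\<^sub>R \<omega>)) ** mexp (t *\<^sub>R B') ** Z' \<theta>"
    using conj(5) by blast
  note intertwines = twisted_conjugacy_intertwines[OF \<omega> \<kappa> Z X sf, folded Z'_def]
  have Xinv: "invertible (X t \<theta>)" for t \<theta>
    using mexp_minus[of "- t" B] unfolding X
    by (intro invertible_mult invertible_matrix_inv Z) (auto intro: matrix_inv_eqI(1))
  have invE: "matrix_inv (mexp (t *\<^sub>R B)) = mexp (- t *\<^sub>R B)" for t
    using mexp_minus[of "- t" B] by (auto intro: matrix_inv_eqI(2))
  have inv1: "matrix_inv (mat 1) = (mat 1 :: complex^'n^'n)" by (rule matrix_inv_eqI(2)) simp
  have real: "\<forall>\<theta>. real_entries (Z' \<theta>)" if odd: "\<forall>b. \<kappa> (- b) = - \<kappa> b" and Xr: "\<forall>t \<theta>. real_entries (X t \<theta>)"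
  proof
    fix \<theta>
    have "mat 1 ** Z' \<theta> = mat_cnj (Z' \<theta>) ** mat 1"
    proof (rule intertwines[where \<sigma> = mat_cnj])
      show "spectral_family (\<lambda>t. mat_cnj (mexp (t *\<^sub>R B))) I (\<lambda>a. cnj (id a)) (\<lambda>a. mat_cnj (P a))"
        by (rule spectral_family_cnj[OF sf])
      show "continuous_on UNIV (\<lambda>\<theta>. mat_cnj (Z \<theta>))"
        by (intro continuous_on_matrixI) (simp, intro continuous_intros Z)
      show "mat 1 ** X t \<theta> = mat_cnj (X t \<theta>) ** mat 1" for t \<theta>
        using Xr by (simp add: real_entries_iff)
    qed (simp_all add: mat_cnj_mult mat_cnj_spectral_twist[OF odd])
    then show "real_entries (Z' \<theta>)" by (simp add: real_entries_iff)
  qed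
  have bil: "\<forall>\<theta>. transpose (Z' \<theta>) ** C ** Z' \<theta> = C"
    if odd: "\<forall>b. \<kappa> (- b) = - \<kappa> b" and XC: "\<forall>t \<theta>. transpose (X t \<theta>) ** C ** X t \<theta> = C" for C
  proof
    fix \<theta>
    have "C ** Z' \<theta> = transpose (matrix_inv (Z' \<theta>)) ** C"
    proof (rule intertwines[where \<sigma> = "\<lambda>M. transpose (matrix_inv M)"])
      have "continuous_on UNIV (\<lambda>\<theta>. matrix_inv (Z \<theta>))" by (intro continuous_on_matrix_inv Z)
      then show "continuous_on UNIV (\<lambda>\<theta>. transpose (matrix_inv (Z \<theta>)))"
        by (intro continuous_on_matrixI) (simp add: transpose_def, intro continuous_intros)
      show "spectral_family (\<lambda>t. transpose (matrix_inv (mexp (t *\<^sub>R B)))) I (\<lambda>a. - id a) (\<lambda>a. transpose (P a))"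
        unfolding invE by (rule spectral_family_transpose[OF sf])
      show "C ** X t \<theta> = transpose (matrix_inv (X t \<theta>)) ** C" for t \<theta>
      proof -
        have "transpose (matrix_inv (X t \<theta>)) ** transpose (X t \<theta>) = mat 1"
          by (simp add: matrix_transpose_mul[symmetric] matrix_inv(1)[OF Xinv])
        then show ?thesis using XC by (metis matrix_mul_assoc matrix_mul_lid)
      qed
    qed (simp_all add: inv1 matrix_inv_mult matrix_transpose_mul transpose_inv_spectral_twist[OF sf odd])
    moreover have "transpose (Z' \<theta>) ** transpose (matrix_inv (Z' \<theta>)) = mat 1"
      by (simp add: matrix_transpose_mul[symmetric] matrix_inv(2)[OF conj(3)])
    ultimately show "transpose (Z' \<theta>) ** C ** Z' \<theta> = C" by (metis matrix_mul_assoc matrix_mul_lid)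
  qed
  have herm: "\<forall>\<theta>. conj_transpose (Z' \<theta>) ** Z' \<theta> = mat 1"
    if XC: "\<forall>t \<theta>. conj_transpose (X t \<theta>) ** X t \<theta> = mat 1"
  proof
    fix \<theta>
    have ct_mult: "conj_transpose (M ** N) = conj_transpose N ** conj_transpose M" for M N :: "complex^'n^'n"
      by (simp add: conj_transpose_eq mat_cnj_mult matrix_transpose_mul)
    have ct1: "conj_transpose (mat 1) = (mat 1 :: complex^'n^'n)" by (simp add: conj_transpose_eq)
    have "mat 1 ** Z' \<theta> = conj_transpose (matrix_inv (Z' \<theta>)) ** mat 1"
    proof (rule intertwines[where \<sigma> = "\<lambda>M. conj_transpose (matrix_inv M)"])
      have "continuous_on UNIV (\<lambda>\<theta>. matrix_inv (Z \<theta>))" by (intro continuous_on_matrix_inv Z)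
      then show "continuous_on UNIV (\<lambda>\<theta>. conj_transpose (matrix_inv (Z \<theta>)))"
        by (intro continuous_on_matrixI) (simp add: conj_transpose_def, intro continuous_intros)
      show "spectral_family (\<lambda>t. conj_transpose (matrix_inv (mexp (t *\<^sub>R B)))) I (\<lambda>a. - cnj (id a))
          (\<lambda>a. conj_transpose (P a))"
        unfolding invE conj_transpose_eq by (rule spectral_family_transpose[OF spectral_family_cnj[OF sf]])
      show "mat 1 ** X t \<theta> = conj_transpose (matrix_inv (X t \<theta>)) ** mat 1" for t \<theta>
        using matrix_inv_eqI(2)[of "X t \<theta>" "conj_transpose (X t \<theta>)"] XC
        by (simp add: matrix_left_right_inverse conj_transpose_def)
    qed (simp_all add: inv1 ct1 matrix_inv_mult ct_mult conj_transpose_inv_spectral_twist[OF sf])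
    then have "conj_transpose (Z' \<theta>) ** Z' \<theta> = conj_transpose (matrix_inv (Z' \<theta>) ** Z' \<theta>)"
      by (simp add: ct_mult)
    then show "conj_transpose (Z' \<theta>) ** Z' \<theta> = mat 1" by (simp add: matrix_inv(2)[OF conj(3)] ct1)
  qed
  show ?thesis by (rule that[OF conj(1-4) B' real bil herm])
qed

section \<open>The four groups\<close>

lemma reducible_modI:
  assumes "continuous_on UNIV Z" "torus_periodic N Z" "\<And>\<theta>. Z \<theta> \<in> G"
    and "\<And>t. mexp (t *\<^sub>R B) = Z (t *\<^sub>R \<omega>) ** X t 0"
    and "\<And>t \<theta>. X t \<theta> = matrix_inv (Z (\<theta> + t *\<^sub>R \<omega>)) ** mexp (t *\<^sub>R B) ** Z \<theta>"
    and "\<And>t \<theta>. X t \<theta> \<in> G" and "\<And>M N. M \<in> G \<Longrightarrow> N \<in> G \<Longrightarrow> M ** N \<in> G"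
  shows "reducible_mod G N \<omega> X"
proof -
  have "B \<in> lie_algebra G" unfolding lie_algebra_def mem_Collect_eq assms(4) by (intro allI assms(7,3,6))
  with assms(1-3,5) show ?thesis unfolding reducible_mod_def by (intro exI[of _ Z] exI[of _ B]) blast
qed

lemma real_entries_mult: "real_entries M \<Longrightarrow> real_entries N \<Longrightarrow> real_entries (M ** N)"
  by (simp add: real_entries_iff mat_cnj_mult)

lemma det_real: "real_entries M \<Longrightarrow> det M \<in> \<real>"
  unfolding det_def real_entries_def by (intro sum_in_Reals Reals_mult prod_in_Reals) auto

text \<open>If \<open>\<bar>f(t)\<bar> > 1\<close>, the powers \<open>f(nt)\<close> would be unbounded; applied to \<open>t\<close> and \<open>-t\<close> this gives
  \<open>\<bar>f\<bar> = 1\<close>. The sign is positive because \<open>f(t) = f(t/2)\<^sup>2\<close>.\<close>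
lemma bounded_real_character_trivial:
  fixes f :: "real \<Rightarrow> complex"
  assumes add: "\<And>s t. f (s + t) = f s * f t" and 0: "f 0 = 1"
    and real: "\<And>t. f t \<in> \<real>" and bd: "\<And>t. norm (f t) \<le> M"
  shows "f t = 1"
proof -
  have le: "norm (f t) \<le> 1" for t
  proof (rule ccontr)
    assume "\<not> norm (f t) \<le> 1"
    moreover have "f (real n * t) = f t ^ n" for n
      by (induction n) (simp_all add: 0 add algebra_simps)
    then have "norm (f t) ^ n \<le> M" for n using bd[of "real n * t"] by (simp add: norm_power)
    ultimately show False
      by (meson linorder_not_le real_arch_pow)
  qed
  have "f t * f (- t) = 1" using add[of t "- t"] 0 by simp
  then have "norm (f t) * norm (f (- t)) = 1" by (metis norm_mult norm_one)
  then have "norm (f t) = 1"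
    using le[of t] le[of "- t"] mult_left_le[of "norm (f (- t))" "norm (f t)"] by simp
  moreover obtain r where r: "f (t / 2) = of_real r" using real[of "t / 2"] by (elim Reals_cases)
  have ft: "f t = of_real (r * r)" using add[of "t / 2" "t / 2"] r by simp
  ultimately have "\<bar>r * r\<bar> = 1" by (simp only: norm_of_real)
  then have "r * r = 1" by (simp only: abs_mult_self_eq abs_mult)
  then show ?thesis using ft by simp
qed

text \<open>The determinant of \<open>e\<^sup>t\<^sup>B\<close> equals \<open>det Z(t\<omega>)\<close> and is therefore real and bounded, which forces it
  to be \<open>1\<close>. Then \<open>det Z\<close> is invariant under the flow.\<close>
lemma det_conjugacy_eq_1:
  fixes X :: "real \<Rightarrow> real^'d \<Rightarrow> complex^'n^'n"
  assumes \<omega>: "rationally_independent \<omega>"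
    and Z: "continuous_on UNIV Z" "torus_periodic N Z" "N > 0" "Z 0 = mat 1" "\<And>\<theta>. real_entries (Z \<theta>)"
    and E: "\<And>t. mexp (t *\<^sub>R B) = Z (t *\<^sub>R \<omega>) ** X t 0"
    and X: "\<And>t \<theta>. X t \<theta> = matrix_inv (Z (\<theta> + t *\<^sub>R \<omega>)) ** mexp (t *\<^sub>R B) ** Z \<theta>"
    and inv: "\<And>\<theta>. invertible (Z \<theta>)" and det: "\<And>t \<theta>. det (X t \<theta>) = 1"
  shows "det (Z \<theta>) = 1"
proof -
  \<comment> \<open>Rescaling gives a function of period \<open>1\<close>, still invariant under the flow of \<open>\<omega>\<close>.\<close>
  define g where "g \<theta> = det (Z (real N *\<^sub>R \<theta>))" for \<theta>
  have g: "continuous_on UNIV g"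
    unfolding g_def
    by (intro continuous_on_det continuous_on_compose2[OF Z(1)] continuous_intros) auto
  have gp: "torus_periodic 1 g"
    using Z(2) by (simp add: torus_periodic_def g_def scaleR_add_right)
  have Zg: "det (Z \<theta>) = g ((1 / real N) *\<^sub>R \<theta>)" for \<theta> using Z(3) by (simp add: g_def)
  obtain M where M: "\<And>\<theta>. norm (g \<theta>) \<le> M" using torus_periodic_bounded[OF g gp] by blast
  have fZ: "det (mexp (t *\<^sub>R B)) = det (Z (t *\<^sub>R \<omega>))" for t by (simp add: E det_mul det)
  have one: "det (mexp (t *\<^sub>R B)) = 1" for t
  proof (rule bounded_real_character_trivial[where M = M])
    show "det (mexp ((s + t) *\<^sub>R B)) = det (mexp (s *\<^sub>R B)) * det (mexp (t *\<^sub>R B))" for s t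
      by (simp add: mexp_add det_mul)
    show "det (mexp (t *\<^sub>R B)) \<in> \<real>" for t unfolding fZ by (intro det_real Z)
    show "norm (det (mexp (t *\<^sub>R B))) \<le> M" for t unfolding fZ Zg by (rule M)
  qed simp
  have flow: "det (Z (\<theta> + t *\<^sub>R \<omega>)) = det (Z \<theta>)" for t \<theta>
  proof -
    have "Z (\<theta> + t *\<^sub>R \<omega>) ** X t \<theta> = mexp (t *\<^sub>R B) ** Z \<theta>"
      unfolding X by (simp add: matrix_mul_assoc matrix_inv[OF inv])
    then have "det (Z (\<theta> + t *\<^sub>R \<omega>) ** X t \<theta>) = det (mexp (t *\<^sub>R B) ** Z \<theta>)" by simp
    then show ?thesis by (simp add: det_mul det one)
  qed
  have "g ((1 / real N) *\<^sub>R \<theta>) = g 0"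
  proof (rule flow_invariant_imp_constant[OF \<omega> g gp])
    show "g (\<theta> + t *\<^sub>R \<omega>) = g \<theta>" for t \<theta>
      using flow[of "real N *\<^sub>R \<theta>" "real N * t"] by (simp add: g_def scaleR_add_right)
  qed
  then show ?thesis unfolding Zg[symmetric] by (simp add: g_def Z(4))
qed

theorem theorem2:
  fixes \<omega> :: "real^'d"
  assumes "rationally_independent \<omega>"
  shows
    "(\<forall>X :: real \<Rightarrow> real^'d \<Rightarrow> complex^('m::finite + 'm)^('m + 'm).
        continuous_cocycle Sp_R \<omega> X \<and> reducible GL_C \<omega> X \<longrightarrow> reducible_mod Sp_R 2 \<omega> X) \<and>
     (\<forall>X :: real \<Rightarrow> real^'d \<Rightarrow> complex^'n^'n.
        (continuous_cocycle SL_R \<omega> X \<and> reducible GL_C \<omega> X \<longrightarrow> reducible_mod SL_R 2 \<omega> X) \<and>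
        (continuous_cocycle O_R \<omega> X \<and> reducible GL_C \<omega> X \<longrightarrow> reducible_mod O_R 2 \<omega> X) \<and>
        (continuous_cocycle U_C \<omega> X \<and> reducible GL_C \<omega> X \<longrightarrow> reducible_mod U_C 1 \<omega> X))"
proof -
  obtain \<kappa> where \<kappa>: "resonance_equivariant \<omega> \<kappa>" "\<forall>b. \<kappa> (- b) = - \<kappa> b"
    "\<And>b. \<exists>m\<in>int_lattice. \<kappa> b = pi *\<^sub>R m"
    using exists_odd_half_integral_shift[OF assms] by metis
  have triv2: "\<forall>b. \<forall>k\<in>int_lattice. plane_wave (\<kappa> b) (real 2 *\<^sub>R k) = 1"
  proof (intro allI ballI)
    fix b and k :: "real^'d" assume k: "k \<in> int_lattice"
    obtain m where "m \<in> int_lattice" "\<kappa> b = pi *\<^sub>R m" using \<kappa>(3) by blast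
    then show "plane_wave (\<kappa> b) (real 2 *\<^sub>R k) = 1"
      using inner_int_lattice[OF _ k, of m] by (intro plane_wave_eq_1[of "m \<bullet> k"]) simp_all
  qed
  obtain \<rho> where \<rho>: "resonance_equivariant \<omega> \<rho>" "\<And>b. \<exists>m\<in>int_lattice. \<rho> b = (2 * pi) *\<^sub>R m"
    using exists_integral_shift[OF assms] by blast
  have triv1: "\<forall>b. \<forall>k\<in>int_lattice. plane_wave (\<rho> b) (real 1 *\<^sub>R k) = 1"
  proof (intro allI ballI)
    fix b and k :: "real^'d" assume k: "k \<in> int_lattice"
    obtain m where "m \<in> int_lattice" "\<rho> b = (2 * pi) *\<^sub>R m" using \<rho>(2) by blast
    then show "plane_wave (\<rho> b) (real 1 *\<^sub>R k) = 1"
      using inner_int_lattice[OF _ k, of m] by (intro plane_wave_eq_1[of "m \<bullet> k"]) simp_all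
  qed
  have in_group: "X t \<theta> \<in> G" if "continuous_cocycle G \<omega> X" for G X t \<theta>
    using that by (simp add: continuous_cocycle_def)
  have form_mult: "transpose (M ** N) ** C ** (M ** N) = C"
    if "transpose M ** C ** M = C" "transpose N ** C ** N = C" for M N C :: "complex^'k^'k"
    using that by (metis matrix_mul_assoc matrix_transpose_mul)
  have "reducible_mod Sp_R 2 \<omega> X" if X: "continuous_cocycle Sp_R \<omega> X" and red: "reducible GL_C \<omega> X"
    for X :: "real \<Rightarrow> real^'d \<Rightarrow> complex^('m + 'm)^('m + 'm)"
  proof (rule reducible_normal_form[OF assms red \<kappa>(1) triv2])
    note XG = in_group[OF X, unfolded Sp_R_def mem_Collect_eq]
    fix Z B
    assume Z: "continuous_on UNIV Z" "torus_periodic 2 Z" "\<And>t. mexp (t *\<^sub>R B) = Z (t *\<^sub>R \<omega>) ** X t 0"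
      "\<And>t \<theta>. X t \<theta> = matrix_inv (Z (\<theta> + t *\<^sub>R \<omega>)) ** mexp (t *\<^sub>R B) ** Z \<theta>"
      and real: "(\<forall>b. \<kappa> (- b) = - \<kappa> b) \<Longrightarrow> (\<forall>t \<theta>. real_entries (X t \<theta>)) \<Longrightarrow> (\<forall>\<theta>. real_entries (Z \<theta>))"
      and form: "\<And>C. (\<forall>b. \<kappa> (- b) = - \<kappa> b) \<Longrightarrow> (\<forall>t \<theta>. transpose (X t \<theta>) ** C ** X t \<theta> = C) \<Longrightarrow>
        (\<forall>\<theta>. transpose (Z \<theta>) ** C ** Z \<theta> = C)"
    show ?thesis
    proof (rule reducible_modI[OF Z(1,2) _ Z(3,4) in_group[OF X]])
      show "Z \<theta> \<in> Sp_R" for \<theta> using real[OF \<kappa>(2)] form[OF \<kappa>(2)] XG by (simp add: Sp_R_def)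
    qed (auto simp: Sp_R_def real_entries_mult form_mult)
  qed
  moreover have "reducible_mod SL_R 2 \<omega> X" if X: "continuous_cocycle SL_R \<omega> X" and red: "reducible GL_C \<omega> X"
    for X :: "real \<Rightarrow> real^'d \<Rightarrow> complex^'n^'n"
  proof (rule reducible_normal_form[OF assms red \<kappa>(1) triv2])
    note XG = in_group[OF X, unfolded SL_R_def mem_Collect_eq]
    fix Z B
    assume Z: "continuous_on UNIV Z" "torus_periodic 2 Z" "\<And>t. mexp (t *\<^sub>R B) = Z (t *\<^sub>R \<omega>) ** X t 0"
      "\<And>t \<theta>. X t \<theta> = matrix_inv (Z (\<theta> + t *\<^sub>R \<omega>)) ** mexp (t *\<^sub>R B) ** Z \<theta>"
      and inv: "\<And>\<theta>. invertible (Z \<theta>)" and Z0: "Z 0 = mat 1"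
      and real: "(\<forall>b. \<kappa> (- b) = - \<kappa> b) \<Longrightarrow> (\<forall>t \<theta>. real_entries (X t \<theta>)) \<Longrightarrow> (\<forall>\<theta>. real_entries (Z \<theta>))"
    have Zr: "real_entries (Z \<theta>)" for \<theta> using real[OF \<kappa>(2)] XG by simp
    have "det (Z \<theta>) = 1" for \<theta>
      by (rule det_conjugacy_eq_1[OF assms Z(1,2) _ Z0 Zr Z(3,4) inv]) (use XG in simp_all)
    then show ?thesis
      by (intro reducible_modI[OF Z(1,2) _ Z(3,4) in_group[OF X]])
         (auto simp: SL_R_def real_entries_mult det_mul Zr)
  qed
  moreover have "reducible_mod O_R 2 \<omega> X" if X: "continuous_cocycle O_R \<omega> X" and red: "reducible GL_C \<omega> X"
    for X :: "real \<Rightarrow> real^'d \<Rightarrow> complex^'n^'n"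
  proof (rule reducible_normal_form[OF assms red \<kappa>(1) triv2])
    have O: "M \<in> O_R \<longleftrightarrow> real_entries M \<and> transpose M ** mat 1 ** M = mat 1" for M :: "complex^'n^'n"
      by (auto simp: O_R_def orthogonal_matrix_def matrix_left_right_inverse)
    note XG = in_group[OF X, unfolded O]
    fix Z B
    assume Z: "continuous_on UNIV Z" "torus_periodic 2 Z" "\<And>t. mexp (t *\<^sub>R B) = Z (t *\<^sub>R \<omega>) ** X t 0"
      "\<And>t \<theta>. X t \<theta> = matrix_inv (Z (\<theta> + t *\<^sub>R \<omega>)) ** mexp (t *\<^sub>R B) ** Z \<theta>"
      and real: "(\<forall>b. \<kappa> (- b) = - \<kappa> b) \<Longrightarrow> (\<forall>t \<theta>. real_entries (X t \<theta>)) \<Longrightarrow> (\<forall>\<theta>. real_entries (Z \<theta>))"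
      and form: "\<And>C. (\<forall>b. \<kappa> (- b) = - \<kappa> b) \<Longrightarrow> (\<forall>t \<theta>. transpose (X t \<theta>) ** C ** X t \<theta> = C) \<Longrightarrow>
        (\<forall>\<theta>. transpose (Z \<theta>) ** C ** Z \<theta> = C)"
    show ?thesis
    proof (rule reducible_modI[OF Z(1,2) _ Z(3,4) in_group[OF X]])
      show "Z \<theta> \<in> O_R" for \<theta> unfolding O using real[OF \<kappa>(2)] form[OF \<kappa>(2)] XG by blast
      show "M ** N \<in> O_R" if "M \<in> O_R" "N \<in> O_R" for M N :: "complex^'n^'n"
        using that form_mult[of M "mat 1" N] unfolding O by (blast intro: real_entries_mult)
    qed
  qed
  moreover have "reducible_mod U_C 1 \<omega> X" if X: "continuous_cocycle U_C \<omega> X" and red: "reducible GL_C \<omega> X"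
    for X :: "real \<Rightarrow> real^'d \<Rightarrow> complex^'n^'n"
  proof (rule reducible_normal_form[OF assms red \<rho>(1) triv1])
    note XG = in_group[OF X, unfolded U_C_def mem_Collect_eq]
    fix Z B
    assume Z: "continuous_on UNIV Z" "torus_periodic 1 Z" "\<And>t. mexp (t *\<^sub>R B) = Z (t *\<^sub>R \<omega>) ** X t 0"
      "\<And>t \<theta>. X t \<theta> = matrix_inv (Z (\<theta> + t *\<^sub>R \<omega>)) ** mexp (t *\<^sub>R B) ** Z \<theta>"
      and herm: "(\<forall>t \<theta>. conj_transpose (X t \<theta>) ** X t \<theta> = mat 1) \<Longrightarrow>
        (\<forall>\<theta>. conj_transpose (Z \<theta>) ** Z \<theta> = mat 1)"
    show ?thesis
    proof (rule reducible_modI[OF Z(1,2) _ Z(3,4) in_group[OF X]])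
      show "Z \<theta> \<in> U_C" for \<theta> using herm XG by (simp add: U_C_def)
      show "M ** N \<in> U_C" if "M \<in> U_C" "N \<in> U_C" for M N :: "complex^'n^'n"
        using that unfolding U_C_def mem_Collect_eq conj_transpose_eq mat_cnj_mult matrix_transpose_mul
        by (metis matrix_mul_assoc matrix_mul_rid)
    qed
  qed
  ultimately show ?thesis by blast
qed

end
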